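(* For $s\in\mathbb Z_2$, define coefficientwise $$\mathcal N_s(q):=\sum_{\substack{m\ge1\\ m\text{ odd}}}\chi_8(m)\,m\,(m^2)^s\,q^{(m^2-1)/8},\qquad \mathcal W_s(q):=\frac{\mathcal N_s(q)}{D(q)}.$$ Then $\mathcal N_s,\mathcal W_s\in\mathbb Z_2[[q]]$, and, for every $r\ge0$, the maps $$s\longmapsto[q^r]\mathcal N_s(q),\qquad s\longmapsto[q^r]\mathcal W_s(q)$$ are $2$-adic analytic on $\mathbb Z_2$. For every nonnegative integer $n$, $$\mathcal N_n=N_n,\qquad \mathcal W_n=W_n .$$ If $s,t\in\mathbb Z_2$ and $s\ne t$, then $$\mathcal W_s(q)\equiv\mathcal W_t(q)\pmod{2^{3+\nu_2(s-t)}}$$ coefficientwise. The exponent is optimal for every pair $s\ne t$. Indeed, $$[q]\mathcal W_s(q)=3(1-9^s),\qquad \nu_2\bigl([q](\mathcal W_s-\mathcal W_t)\bigr)=3+\nu_2(s-t).$$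
   Context: Put $T_k=k(k+1)/2$ and let $\chi_8(m)=\left(\frac2m\right)$ be the primitive even quadratic character modulo $8$. For integers $n\ge0$, let $N_n(q):=\sum_{k\ge0}(-1)^{T_k}(2k+1)^{2n+1}q^{T_k}$, $D:=N_0$, and $W_n:=N_n/D\in\mathbb Z[[q]]$ (formal power series, $D(0)=1$). For $v\in1+8\mathbb Z_2$ and $s\in\mathbb Z_2$, $v^s:=\exp(s\log v)$ with the $2$-adic logarithm and exponential (which converge); this agrees with the usual power for nonnegative integers $s$. For odd $m$ one has $m^2\in1+8\mathbb Z_2$, so $(m^2)^s$ is defined. $[q^r]F$ denotes the coefficient of $q^r$ in $F$, and $\nu_2$ is the normalized $2$-adic valuation. "$2$-adic analytic on $\mathbb Z_2$" means given by a power series in $s$ with coefficients in $\mathbb Q_2$ converging on all of $\mathbb Z_2$. *)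

theory Defs
  imports
    Complex_Main
    "HOL-Computational_Algebra.Fraction_Field"
    "HOL-Computational_Algebra.Formal_Power_Series"
    "HOL-Number_Theory.Number_Theory"
begin

section \<open>The ring of 2-adic integers\<close>

text \<open>
  The inverse limit of the rings of integers modulo \<open>2 ^ n\<close>: the \<open>n\<close>-th component is the least
  nonnegative residue modulo \<open>2 ^ n\<close>.
\<close>

typedef two_adic_int = "{f :: nat \<Rightarrow> int. \<forall>n. f (Suc n) mod 2 ^ n = f n}"
  morphisms residue Abs_two_adic_int
  by (rule exI [of _ "\<lambda>_. 0"]) simp

setup_lifting type_definition_two_adic_int

lemma mod_mod_two_power: "(a :: int) mod 2 ^ Suc n mod 2 ^ n = a mod 2 ^ n"
  by (simp add: mod_mod_cancel)

instantiation two_adic_int :: comm_ring_1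
begin

lift_definition zero_two_adic_int :: two_adic_int is "\<lambda>_. 0" by simp
lift_definition one_two_adic_int :: two_adic_int is "\<lambda>n. 1 mod 2 ^ n"
  by (rule mod_mod_two_power)
lift_definition plus_two_adic_int :: "two_adic_int \<Rightarrow> two_adic_int \<Rightarrow> two_adic_int"
  is "\<lambda>f g n. (f n + g n) mod 2 ^ n"
  by (metis mod_add_eq mod_mod_two_power)
lift_definition times_two_adic_int :: "two_adic_int \<Rightarrow> two_adic_int \<Rightarrow> two_adic_int"
  is "\<lambda>f g n. (f n * g n) mod 2 ^ n"
  by (metis mod_mult_eq mod_mod_two_power)
lift_definition uminus_two_adic_int :: "two_adic_int \<Rightarrow> two_adic_int"
  is "\<lambda>f n. (- f n) mod 2 ^ n"
  by (metis mod_minus_eq mod_mod_two_power)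
lift_definition minus_two_adic_int :: "two_adic_int \<Rightarrow> two_adic_int \<Rightarrow> two_adic_int"
  is "\<lambda>f g n. (f n - g n) mod 2 ^ n"
  by (metis mod_diff_eq mod_mod_two_power)

lemma coherent_mod:
  assumes "\<forall>n. (f :: nat \<Rightarrow> int) (Suc n) mod 2 ^ n = f n"
  shows "f n mod 2 ^ n = f n"
  by (metis assms mod_mod_trivial)

instance
proof
  fix a b c :: two_adic_int
  show "a * b * c = a * (b * c)"
    by transfer (simp add: fun_eq_iff mod_mult_left_eq mod_mult_right_eq mult.assoc)
  show "a * b = b * a"
    by transfer (simp add: mult.commute)
  show "1 * a = a"
    by transfer (simp add: fun_eq_iff mod_mult_left_eq coherent_mod, drule spec [of _ 0], simp)
  show "a + b + c = a + (b + c)"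
    by transfer (simp add: fun_eq_iff mod_add_left_eq mod_add_right_eq add.assoc)
  show "a + b = b + a"
    by transfer (simp add: add.commute)
  show "0 + a = a"
    by transfer (simp add: fun_eq_iff coherent_mod)
  show "- a + a = 0"
    by transfer (simp add: fun_eq_iff mod_add_left_eq)
  show "a - b = a + - b"
    by transfer (simp add: fun_eq_iff mod_add_right_eq)
  show "(a + b) * c = a * c + b * c"
    by transfer (simp add: fun_eq_iff mod_mult_left_eq mod_add_eq distrib_right)
  show "(0 :: two_adic_int) \<noteq> 1"
    by transfer (auto dest!: fun_cong [of _ _ 1])
qed

end

lemma residue_eqI: "(\<And>n. residue a n = residue b n) \<Longrightarrow> a = b"
  by (simp add: residue_inject [symmetric] fun_eq_iff)

lemma residue_mod: "residue a (n + k) mod 2 ^ n = residue a n"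
proof (induction k)
  case 0
  show ?case using coherent_mod residue by fastforce
next
  case (Suc k)
  have "residue a (n + k) mod 2 ^ n = residue a (Suc (n + k)) mod 2 ^ (n + k) mod 2 ^ n"
    using residue [of a] by simp
  also have "\<dots> = residue a (n + Suc k) mod 2 ^ n"
    by (simp add: mod_mod_cancel le_imp_power_dvd)
  finally show ?case using Suc by simp
qed

lemma residue_mod_le: "n \<le> m \<Longrightarrow> residue a m mod 2 ^ n = residue a n"
  using residue_mod [of a n "m - n"] by simp

lemma residue_of_nat: "residue (of_nat k) n = int k mod 2 ^ n"
proof (induction k)
  case 0
  show ?case by (simp add: zero_two_adic_int.rep_eq)
next
  case (Suc k)
  then show ?case
    by (simp only: of_nat_Suc plus_two_adic_int.rep_eq one_two_adic_int.rep_eq mod_add_eq)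
qed

lemma residue_two_power: "residue (2 ^ j) n = 2 ^ j mod 2 ^ n"
  using residue_of_nat [of "2 ^ j" n] by simp

lemma residue_two_power_mult: "residue (2 ^ j * a) n = 2 ^ j * residue a n mod 2 ^ n"
  by (simp add: times_two_adic_int.rep_eq residue_two_power mod_mult_left_eq)

lemma two_adic_int_divide:
  assumes "residue a j = 0"
  obtains b where "a = 2 ^ j * b" "\<And>n. residue b n = residue a (n + j) div 2 ^ j"
proof -
  let ?b = "\<lambda>n. residue a (n + j) div 2 ^ j"
  have "?b (Suc n) mod 2 ^ n = ?b n" for n
  proof -
    have "residue a (n + j) = residue a (Suc n + j) mod 2 ^ (n + j)"
      by (simp add: residue_mod_le)
    also have "\<dots> div 2 ^ j = (residue a (Suc n + j) div 2 ^ j) mod 2 ^ n"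
      by (simp add: power_add mult.commute [of "2 ^ n"] zmod_zmult2_eq)
    finally show ?thesis by simp
  qed
  then have b: "residue (Abs_two_adic_int ?b) = ?b"
    by (intro Abs_two_adic_int_inverse) blast
  have "residue a n = residue (2 ^ j * Abs_two_adic_int ?b) n" for n
  proof -
    have "residue a (n + j) mod 2 ^ j = 0"
      using assms residue_mod [of a j n] by (simp add: add.commute)
    then have "2 ^ j * ?b n = residue a (n + j)"
      by auto
    then show ?thesis by (simp add: residue_two_power_mult b residue_mod)
  qed
  then have "a = 2 ^ j * Abs_two_adic_int ?b" by (rule residue_eqI)
  with b show thesis by (intro that) auto
qed

lemma two_adic_int_unit:
  assumes "residue a 1 \<noteq> 0"
  obtains b where "a * b = 1"
proof -
  have "residue a (1 + n) mod 2 ^ 1 \<noteq> 0" for n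
    using assms unfolding residue_mod .
  then have odd: "odd (residue a n)" if "n > 0" for n
    using that by (metis Suc_pred' even_iff_mod_2_eq_zero plus_1_eq_Suc power_one_right)
  have "\<exists>z. [residue a n * z = 1] (mod 2 ^ n)" for n
    using odd [of n] by (cases "n = 0") (auto intro!: cong_solve_coprime_int)
  then obtain z where z: "\<And>n. [residue a n * z n = 1] (mod 2 ^ n)" by metis
  let ?b = "\<lambda>n. z n mod 2 ^ n"
  have "?b (Suc n) mod 2 ^ n = ?b n" for n
  proof (cases "n = 0")
    case False
    have "[residue a (Suc n) * z (Suc n) = 1] (mod 2 ^ n)"
      using z [of "Suc n"] by (rule cong_dvd_modulus) simp
    moreover have "[residue a (Suc n) = residue a n] (mod 2 ^ n)"
      using residue_mod [of a n 1] residue_mod [of a n 0] by (simp add: cong_def)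
    ultimately have "[residue a n * z (Suc n) = residue a n * z n] (mod 2 ^ n)"
      by (metis cong_mult cong_refl cong_sym cong_trans z)
    then have "[z (Suc n) = z n] (mod 2 ^ n)"
      using odd [of n] False by (subst (asm) cong_mult_lcancel) auto
    then show ?thesis
      unfolding mod_mod_two_power by (simp add: cong_def)
  qed simp
  then have b: "residue (Abs_two_adic_int ?b) = ?b"
    by (intro Abs_two_adic_int_inverse) blast
  have "a * Abs_two_adic_int ?b = 1"
    using z by (intro residue_eqI)
      (simp add: times_two_adic_int.rep_eq one_two_adic_int.rep_eq b mod_mult_right_eq cong_def)
  then show thesis by (rule that)
qed

lemma two_adic_int_decompose:
  fixes a :: two_adic_int
  assumes "a \<noteq> 0"
  obtains j u v where "a = 2 ^ j * u" "u * v = 1"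
proof -
  have ex: "\<exists>n. residue a n \<noteq> 0"
    using assms by (metis residue_eqI zero_two_adic_int.rep_eq)
  define n where "n = (LEAST n. residue a n \<noteq> 0)"
  have n: "residue a n \<noteq> 0" using ex unfolding n_def by (rule LeastI_ex)
  have "residue a 0 = 0" using residue_mod [of a 0 0] by simp
  with n obtain j where j: "n = Suc j" by (cases n) auto
  have "residue a j = 0"
    using not_less_Least [of j "\<lambda>n. residue a n \<noteq> 0"] unfolding n_def [symmetric] j by auto
  then obtain b where ab: "a = 2 ^ j * b" and b: "\<And>n. residue b n = residue a (n + j) div 2 ^ j"
    by (rule two_adic_int_divide) blast
  have "residue b 1 \<noteq> 0"
  proof
    assume "residue b 1 = 0"
    then have "residue (2 ^ j * b) n = 0"
      using residue_mod [of b 1 j] residue_two_power_mult [of j b n] j by (auto elim!: evenE)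
    with n ab show False by simp
  qed
  then obtain v where "b * v = 1" by (rule two_adic_int_unit)
  with ab show thesis by (rule that)
qed

instance two_adic_int :: idom
proof
  fix a b :: two_adic_int
  assume "a \<noteq> 0" "b \<noteq> 0"
  obtain i u u' where a: "a = 2 ^ i * u" "u * u' = 1"
    using \<open>a \<noteq> 0\<close> by (rule two_adic_int_decompose)
  obtain j v v' where b: "b = 2 ^ j * v" "v * v' = 1"
    using \<open>b \<noteq> 0\<close> by (rule two_adic_int_decompose)
  have "a * b * (u' * v') = 2 ^ (i + j) * (u * u') * (v * v')"
    by (simp add: a b power_add mult_ac)
  then have "a * b * (u' * v') = 2 ^ (i + j)" using a b by simp
  moreover have "residue (2 ^ (i + j)) (Suc (i + j)) \<noteq> 0"
    by (simp add: residue_two_power)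
  ultimately show "a * b \<noteq> 0"
    by (metis mult_zero_left zero_two_adic_int.rep_eq)
qed


section \<open>The field of 2-adic numbers\<close>

text \<open>
  The field of fractions of \<^typ>\<open>two_adic_int\<close>, copied to a type of its own so that it can
  carry the 2-adic metric.
\<close>

typedef two_adic = "UNIV :: two_adic_int fract set"
  by simp

setup_lifting type_definition_two_adic

instantiation two_adic :: field
begin

lift_definition zero_two_adic :: two_adic is 0 .
lift_definition one_two_adic :: two_adic is 1 .
lift_definition plus_two_adic :: "two_adic \<Rightarrow> two_adic \<Rightarrow> two_adic" is "(+)" .
lift_definition minus_two_adic :: "two_adic \<Rightarrow> two_adic \<Rightarrow> two_adic" is "(-)" .
lift_definition uminus_two_adic :: "two_adic \<Rightarrow> two_adic" is "uminus" .
lift_definition times_two_adic :: "two_adic \<Rightarrow> two_adic \<Rightarrow> two_adic" is "(*)" .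
lift_definition inverse_two_adic :: "two_adic \<Rightarrow> two_adic" is "inverse" .
lift_definition divide_two_adic :: "two_adic \<Rightarrow> two_adic \<Rightarrow> two_adic" is "(/)" .

instance
  by standard (transfer; simp add: algebra_simps divide_inverse)+

end

definition of_two_adic_int :: "two_adic_int \<Rightarrow> two_adic"
  where "of_two_adic_int a = Abs_two_adic (Fraction_Field.Fract a 1)"

lemma Rep_of_two_adic_int: "Rep_two_adic (of_two_adic_int a) = Fraction_Field.Fract a 1"
  by (simp add: of_two_adic_int_def Abs_two_adic_inverse)

lemmas Rep_two_adic_simps =
  zero_two_adic.rep_eq one_two_adic.rep_eq plus_two_adic.rep_eq minus_two_adic.rep_eq
  uminus_two_adic.rep_eq times_two_adic.rep_eq divide_two_adic.rep_eq Rep_of_two_adic_int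

lemma of_two_adic_int_simps [simp]:
  "of_two_adic_int 0 = 0"
  "of_two_adic_int 1 = 1"
  "of_two_adic_int (a + b) = of_two_adic_int a + of_two_adic_int b"
  "of_two_adic_int (a - b) = of_two_adic_int a - of_two_adic_int b"
  "of_two_adic_int (- a) = - of_two_adic_int a"
  "of_two_adic_int (a * b) = of_two_adic_int a * of_two_adic_int b"
  by (simp_all add: Rep_two_adic_inject [symmetric] Rep_two_adic_simps Fraction_Field.Zero_fract_def Fraction_Field.One_fract_def)

lemma of_two_adic_int_eq_iff [simp]: "of_two_adic_int a = of_two_adic_int b \<longleftrightarrow> a = b"
  by (simp add: Rep_two_adic_inject [symmetric] Rep_two_adic_simps Fraction_Field.eq_fract)

lemma of_two_adic_int_power [simp]: "of_two_adic_int (a ^ n) = of_two_adic_int a ^ n"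
  by (induction n) simp_all

lemma of_two_adic_int_of_nat [simp]: "of_two_adic_int (of_nat n) = of_nat n"
  by (induction n) simp_all

lemma of_two_adic_int_two [simp]: "of_two_adic_int 2 = 2"
  using of_two_adic_int_of_nat [of 2] by simp

lemma two_adic_two_neq_0 [simp]: "(2 :: two_adic) \<noteq> 0"
proof
  assume "(2 :: two_adic) = 0"
  then have "(2 :: two_adic_int) = 0"
    by (metis of_two_adic_int_eq_iff of_two_adic_int_simps(1) of_two_adic_int_two)
  moreover have "residue 2 2 \<noteq> 0"
    using residue_two_power [of 1 2] by simp
  ultimately show False by (simp add: zero_two_adic_int.rep_eq)
qed

definition Z2 :: "two_adic set"
  where "Z2 = range of_two_adic_int"

lemma Z2_closed:
  assumes "x \<in> Z2" "y \<in> Z2"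
  shows "x + y \<in> Z2" "x - y \<in> Z2" "- x \<in> Z2" "x * y \<in> Z2"
  using assms unfolding Z2_def by (auto simp flip: of_two_adic_int_simps)

lemma Z2_two_power: "2 ^ n \<in> Z2"
  unfolding Z2_def by (metis of_two_adic_int_power of_two_adic_int_two rangeI)

lemma Z2_two_powi: "k \<ge> 0 \<Longrightarrow> 2 powi k \<in> Z2"
  by (simp add: power_int_def Z2_two_power)

definition cong_two_powi :: "int \<Rightarrow> two_adic \<Rightarrow> two_adic \<Rightarrow> bool"
  where "cong_two_powi e x y \<longleftrightarrow> (\<exists>z\<in>Z2. x - y = 2 powi e * z)"

text \<open>
  The normalized 2-adic valuation. The value at \<open>0\<close>, which should be infinite, is the dummy
  value \<open>0\<close>.
\<close>

definition val2 :: "two_adic \<Rightarrow> int"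
  where "val2 x = (if x = 0 then 0 else (GREATEST k. \<exists>z\<in>Z2. x = 2 powi k * z))"

lemma two_adic_decompose:
  assumes "x \<noteq> 0"
  obtains k u v where "x = 2 powi k * u" "u \<in> Z2" "v \<in> Z2" "u * v = 1"
proof -
  obtain a b where b0: "b \<noteq> 0" and ab: "x = of_two_adic_int a / of_two_adic_int b"
  proof -
    obtain a b where "Rep_two_adic x = Fraction_Field.Fract a b" "b \<noteq> 0"
      by (rule Fraction_Field.Fract_cases)
    then show thesis
      by (intro that [of b a])
        (simp_all add: Rep_two_adic_inject [symmetric] Rep_two_adic_simps Fraction_Field.divide_fract)
  qed
  with assms have a0: "a \<noteq> 0" by auto
  obtain i u u' where a: "a = 2 ^ i * u" "u * u' = 1"
    using a0 by (rule two_adic_int_decompose)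
  obtain j v v' where b: "b = 2 ^ j * v" "v * v' = 1"
    using b0 by (rule two_adic_int_decompose)
  have inv: "of_two_adic_int u * of_two_adic_int u' = 1" "of_two_adic_int v * of_two_adic_int v' = 1"
    using a(2) b(2) by (metis of_two_adic_int_simps(2,6))+
  have "inverse (of_two_adic_int v) = of_two_adic_int v'"
    using inv(2) by (metis inverse_unique)
  then have "x = 2 powi (int i - int j) * (of_two_adic_int (u * v'))"
    by (simp add: ab a b power_int_diff divide_inverse mult_ac)
  moreover have "of_two_adic_int (u * v') * of_two_adic_int (u' * v) = 1"
    using inv by simp (metis mult.commute mult.left_commute mult_1)
  ultimately show thesis
    by (intro that [of "int i - int j" "of_two_adic_int (u * v')" "of_two_adic_int (u' * v)"])
      (simp_all only: Z2_def rangeI)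
qed

lemma unit_not_two_mult:
  assumes "v \<in> Z2" "u * v = 1" "z \<in> Z2" "d > 0"
  shows "u \<noteq> 2 powi d * z"
proof
  assume u: "u = 2 powi d * z"
  have "2 powi d = 2 * (2 powi (d - 1) :: two_adic)"
    by (simp add: power_int_diff)
  with u assms(2) have one: "1 = 2 * (2 powi (d - 1) * z * v)" by (simp add: mult_ac)
  have "2 powi (d - 1) * z * v \<in> Z2"
    using assms by (intro Z2_closed Z2_two_powi) auto
  then obtain c where "2 powi (d - 1) * z * v = of_two_adic_int c" unfolding Z2_def by auto
  with one have "of_two_adic_int 1 = of_two_adic_int (2 * c)" by simp
  then have "(1 :: two_adic_int) = 2 ^ 1 * c" unfolding of_two_adic_int_eq_iff by simp
  then have "residue 1 1 = 2 ^ 1 * residue c 1 mod 2 ^ 1" by (metis residue_two_power_mult)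
  then show False by (simp add: one_two_adic_int.rep_eq)
qed

lemma val2_eqI:
  assumes x: "x = 2 powi k * u" and u: "u \<in> Z2" "v \<in> Z2" "u * v = 1"
  shows "val2 x = k"
proof -
  have "u \<noteq> 0" using u by auto
  then have x0: "x \<noteq> 0" using x by simp
  have "(GREATEST k. \<exists>z\<in>Z2. x = 2 powi k * z) = k"
  proof (rule Greatest_equality)
    show "\<exists>z\<in>Z2. x = 2 powi k * z" using x u by blast
    fix l assume "\<exists>z\<in>Z2. x = 2 powi l * z"
    then obtain z where z: "z \<in> Z2" "x = 2 powi l * z" by blast
    show "l \<le> k"
    proof (rule ccontr)
      assume "\<not> l \<le> k"
      have "2 powi k * u = 2 powi k * (2 powi (l - k) * z)"
        using z x by (simp add: power_int_diff)
      then have "u = 2 powi (l - k) * z" by simp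
      moreover have "u \<noteq> 2 powi (l - k) * z"
        using u(2,3) z(1) by (rule unit_not_two_mult) (use \<open>\<not> l \<le> k\<close> in simp)
      ultimately show False by simp
    qed
  qed
  then show ?thesis using x0 by (simp add: val2_def)
qed

lemma two_adic_val2_cases:
  assumes "x \<noteq> 0"
  obtains u v where "x = 2 powi val2 x * u" "u \<in> Z2" "v \<in> Z2" "u * v = 1"
  using assms by (metis two_adic_decompose val2_eqI)

lemma val2_ge_iff:
  assumes "x \<noteq> 0"
  shows "val2 x \<ge> k \<longleftrightarrow> (\<exists>z\<in>Z2. x = 2 powi k * z)"
proof -
  obtain u v where uv: "x = 2 powi val2 x * u" "u \<in> Z2" "v \<in> Z2" "u * v = 1"
    using assms by (rule two_adic_val2_cases)
  show ?thesis
  proof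
    assume "val2 x \<ge> k"
    then have "2 powi (val2 x - k) * u \<in> Z2"
      using uv by (intro Z2_closed Z2_two_powi) auto
    moreover have "x = 2 powi k * (2 powi (val2 x - k) * u)"
      using uv(1) by (simp add: power_int_diff)
    ultimately show "\<exists>z\<in>Z2. x = 2 powi k * z" by blast
  next
    assume "\<exists>z\<in>Z2. x = 2 powi k * z"
    then obtain z where z: "z \<in> Z2" "x = 2 powi k * z" by blast
    show "val2 x \<ge> k"
    proof (rule ccontr)
      assume *: "\<not> val2 x \<ge> k"
      have "2 powi val2 x * u = 2 powi val2 x * (2 powi (k - val2 x) * z)"
        using z(2) uv(1) by (simp add: power_int_diff)
      then have "u = 2 powi (k - val2 x) * z" by simp
      moreover have "u \<noteq> 2 powi (k - val2 x) * z"
        using uv(3,4) z(1) by (rule unit_not_two_mult) (use * in simp)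
      ultimately show False by simp
    qed
  qed
qed

lemma val2_minus: "val2 (- x) = val2 x"
proof (cases "x = 0")
  case False
  then obtain u v where "x = 2 powi val2 x * u" "u \<in> Z2" "v \<in> Z2" "u * v = 1"
    by (rule two_adic_val2_cases)
  then show ?thesis
    by (intro val2_eqI [of _ _ "- u" "- v"]) (auto simp: Z2_closed)
qed simp

lemma val2_add:
  assumes "x \<noteq> 0" "y \<noteq> 0" "x + y \<noteq> 0"
  shows "val2 (x + y) \<ge> min (val2 x) (val2 y)"
proof -
  let ?k = "min (val2 x) (val2 y)"
  obtain a where a: "a \<in> Z2" "x = 2 powi ?k * a"
    using assms val2_ge_iff [of x ?k] by auto
  obtain b where b: "b \<in> Z2" "y = 2 powi ?k * b"
    using assms val2_ge_iff [of y ?k] by auto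
  have "x + y = 2 powi ?k * (a + b)"
    using a(2) b(2) by (metis distrib_left)
  then show ?thesis
    using a b assms val2_ge_iff [of "x + y" ?k] Z2_closed by blast
qed

definition abs2 :: "two_adic \<Rightarrow> real"
  where "abs2 x = (if x = 0 then 0 else 2 powi (- val2 x))"

lemma abs2_add: "abs2 (x + y) \<le> abs2 x + abs2 y"
proof (cases "x = 0 \<or> y = 0 \<or> x + y = 0")
  case True
  then show ?thesis by (auto simp: abs2_def)
next
  case False
  then have "- val2 (x + y) \<le> max (- val2 x) (- val2 y)"
    using val2_add [of x y] by auto
  then have "2 powi (- val2 (x + y)) \<le> (2 powi max (- val2 x) (- val2 y) :: real)"
    by (rule power_int_increasing) simp
  also have "\<dots> \<le> 2 powi (- val2 x) + 2 powi (- val2 y)"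
    by (simp add: max_def)
  finally show ?thesis using False by (simp add: abs2_def)
qed

lemma abs2_minus: "abs2 (- x) = abs2 x"
  by (simp add: abs2_def val2_minus)

instantiation two_adic :: metric_space
begin

definition dist_two_adic :: "two_adic \<Rightarrow> two_adic \<Rightarrow> real"
  where "dist_two_adic x y = abs2 (x - y)"

definition uniformity_two_adic :: "(two_adic \<times> two_adic) filter"
  where "uniformity_two_adic = (INF e\<in>{0<..}. principal {(x, y). dist x y < e})"

definition open_two_adic :: "two_adic set \<Rightarrow> bool"
  where "open_two_adic U \<longleftrightarrow> (\<forall>x\<in>U. \<forall>\<^sub>F (x', y) in uniformity. x' = x \<longrightarrow> y \<in> U)"

instance
proof
  fix x y z :: two_adic
  show "dist x y = 0 \<longleftrightarrow> x = y"
    by (simp add: dist_two_adic_def abs2_def)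
  have "abs2 (x - y) \<le> abs2 (x - z) + abs2 (z - y)"
    using abs2_add [of "x - z" "z - y"] by simp
  also have "abs2 (z - y) = abs2 (y - z)"
    using abs2_minus [of "z - y"] by simp
  finally show "dist x y \<le> dist x z + dist y z"
    by (simp add: dist_two_adic_def)
qed (simp_all add: uniformity_two_adic_def open_two_adic_def)

end


section \<open>2-adic logarithm, exponential and powers\<close>

text \<open>
  The logarithm series converges for \<open>v - 1 \<in> 2 Z2\<close> and the exponential series for \<open>x \<in> 4 Z2\<close>;
  the definitions are meaningful only there. For \<open>v - 1 \<in> 8 Z2\<close> and \<open>s \<in> Z2\<close> both converge in
  the definition of \<open>pow2\<close>, since then \<open>s * ln2 v \<in> 8 Z2\<close>.
\<close>

definition ln2 :: "two_adic \<Rightarrow> two_adic"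
  where "ln2 v = (\<Sum>k. (- 1) ^ k * (v - 1) ^ Suc k / of_nat (Suc k))"

definition exp2 :: "two_adic \<Rightarrow> two_adic"
  where "exp2 x = (\<Sum>k. x ^ k / of_nat (fact k))"

definition pow2 :: "two_adic \<Rightarrow> two_adic \<Rightarrow> two_adic"
  where "pow2 v s = exp2 (s * ln2 v)"

text \<open>2-adic analyticity on all of \<^const>\<open>Z2\<close>; only the values of \<open>f\<close> on \<^const>\<open>Z2\<close> matter.\<close>

definition two_adic_analytic :: "(two_adic \<Rightarrow> two_adic) \<Rightarrow> bool"
  where "two_adic_analytic f \<longleftrightarrow>
    (\<exists>a :: nat \<Rightarrow> two_adic. \<forall>s\<in>Z2. (\<lambda>k. a k * s ^ k) sums f s)"


section \<open>The character modulo 8\<close>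

text \<open>
  The Jacobi symbol \<open>(2/m)\<close> for odd \<open>m\<close>. For even \<open>m > 0\<close> the product contains the factor
  \<open>Legendre 2 2 = 0\<close>, as it should. The lemma \<open>chi8_eq\<close> below shows that this is the primitive
  even quadratic character modulo 8.
\<close>

definition chi8 :: "nat \<Rightarrow> int"
  where "chi8 m = (if m = 0 then 0 else (\<Prod>p\<in>#prime_factorization m. Legendre 2 (int p)))"

lemma Legendre_two:
  assumes "prime p" "p > 2"
  shows "Legendre 2 (int p) = (if p mod 8 \<in> {1, 7} then 1 else - 1)"
proof -
  interpret GAUSS p 2
  proof
    show "[2 \<noteq> 0] (mod int p)"
      using assms by (auto simp: cong_0_iff dest: zdvd_imp_le)
  qed (use assms in simp_all)
  define m where "m = (p - 1) div 2"
  have p: "p = 2 * m + 1"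
    using odd_p unfolding m_def by (auto elim!: oddE)
  then have int_p: "int p = 2 * int m + 1" by simp
  then have m: "(int p - 1) div 2 = int m" by simp
  have B: "C = B"
  proof -
    have "x mod int p = x" if "x \<in> B" for x
      using that unfolding B_def A_def by (auto simp: int_p)
    then show ?thesis unfolding C_def by force
  qed
  have E: "E = (\<lambda>x. 2 * x) ` {int (m div 2) <.. int m}"
    unfolding E_def B unfolding B_def A_def m
    by (auto simp: image_iff zdiv_int mult.commute)
  have "card E = m - m div 2"
    unfolding E by (subst card_image) (auto simp: inj_on_def)
  then have L: "Legendre 2 (int p) = (- 1) ^ (m - m div 2)"
    using gauss_lemma by simp
  define k where "k = m div 4"
  have "m mod 4 = 0 \<or> m mod 4 = 1 \<or> m mod 4 = 2 \<or> m mod 4 = 3" by linarith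
  moreover have "m = 4 * k + m mod 4" unfolding k_def by simp
  ultimately consider "m = 4 * k" | "m = 4 * k + 1" | "m = 4 * k + 2" | "m = 4 * k + 3"
    by linarith
  then show ?thesis
  proof cases
    case 1
    then have "m - m div 2 = 2 * k" "p mod 8 = 1" unfolding p by presburger+
    then show ?thesis unfolding L by simp
  next
    case 2
    then have "m - m div 2 = 2 * k + 1" "p mod 8 = 3" unfolding p by presburger+
    then show ?thesis unfolding L by simp
  next
    case 3
    then have "m - m div 2 = 2 * k + 1" "p mod 8 = 5" unfolding p by presburger+
    then show ?thesis unfolding L by simp
  next
    case 4
    then have "m - m div 2 = 2 * (k + 1)" "p mod 8 = 7" unfolding p by presburger+
    then show ?thesis unfolding L by simp
  qed
qed

lemma Legendre_two_prime:
  assumes "prime p"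
  shows "Legendre 2 (int p) = (if even p then 0 else if p mod 8 \<in> {1, 7} then 1 else - 1)"
proof (cases "p = 2")
  case True
  then show ?thesis by (simp add: Legendre_def cong_def)
next
  case False
  then have "p > 2" using assms prime_ge_2_nat [of p] by linarith
  then show ?thesis using assms Legendre_two prime_odd_nat by auto
qed

lemma chi8_eq: "chi8 m = (if even m then 0 else if m mod 8 \<in> {1, 7} then 1 else - 1)"
proof (induction m rule: less_induct)
  case (less m)
  consider "m = 0" | "m = 1" | "m > 1" by linarith
  then show ?case
  proof cases
    case 3
    then obtain p where p: "prime p" "p dvd m" using prime_factor_nat by (metis less_numeral_extra(4))
    then obtain k where k: "m = p * k" by auto
    have "k \<noteq> 0" "p \<noteq> 0" using 3 k by (auto intro: Nat.gr0I)
    then have "k < m" using k prime_gt_1_nat [OF p(1)] by simp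
    have "chi8 m = Legendre 2 (int p) * chi8 k"
      using p \<open>k \<noteq> 0\<close> \<open>p \<noteq> 0\<close>
      by (simp add: chi8_def k prime_factorization_mult prime_factorization_prime)
    also have "\<dots> = (if even m then 0 else if m mod 8 \<in> {1, 7} then 1 else - 1)"
    proof (cases "even m")
      case True
      then show ?thesis using less.IH [OF \<open>k < m\<close>] Legendre_two_prime [OF p(1)] k by auto
    next
      case False
      then have odd: "odd p" "odd k" using k by auto
      have *: "x mod 8 = 1 \<or> x mod 8 = 3 \<or> x mod 8 = 5 \<or> x mod 8 = 7" if "odd x" for x :: nat
        using that by presburger
      have "m mod 8 = (p mod 8) * (k mod 8) mod 8" unfolding k by (simp add: mod_mult_eq)
      then show ?thesis
        using * [OF odd(1)] * [OF odd(2)] odd False less.IH [OF \<open>k < m\<close>] Legendre_two_prime [OF p(1)]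
        by (elim disjE) simp_all
    qed
    finally show ?thesis .
  qed (simp_all add: chi8_def)
qed


section \<open>The power series\<close>

definition tri :: "nat \<Rightarrow> nat"
  where "tri k = k * (k + 1) div 2"

lemma le_tri: "k \<le> tri k"
proof -
  have "2 * k \<le> k * (k + 1)" by (cases k) simp_all
  then show ?thesis unfolding tri_def by linarith
qed

lemma finite_tri_eq: "finite {k. tri k = r}"
  by (rule finite_subset [of _ "{..r}"]) (auto intro: le_tri)

definition N_ser :: "nat \<Rightarrow> int fps"
  where "N_ser n = Abs_fps (\<lambda>r. \<Sum>k | tri k = r. (- 1) ^ tri k * int (2 * k + 1) ^ (2 * n + 1))"

definition D_ser :: "int fps"
  where "D_ser = N_ser 0"

lemma D_ser_0: "fps_nth D_ser 0 = 1"
proof -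
  have "tri k = 0 \<longleftrightarrow> k = 0" for k
    using le_tri [of k] by (cases "k = 0") (simp_all add: tri_def)
  then show ?thesis by (simp add: D_ser_def N_ser_def)
qed

text \<open>
  The quotient \<open>N_ser n / D_ser\<close>, formed in the ring of integral power series, where
  \<^const>\<open>D_ser\<close> is a unit.
\<close>

definition W_ser :: "nat \<Rightarrow> int fps"
  where "W_ser n = N_ser n * fps_right_inverse D_ser 1"

lemma W_ser_mult_D_ser: "W_ser n * D_ser = N_ser n"
  using fps_right_inverse [of D_ser 1] D_ser_0
  by (simp add: W_ser_def mult.assoc mult.commute [of _ D_ser])

definition fps_of_int_fps :: "int fps \<Rightarrow> two_adic fps"
  where "fps_of_int_fps F = Abs_fps (\<lambda>r. of_int (fps_nth F r))"

lemma finite_odd_square_eq: "finite {m :: nat. m \<ge> 1 \<and> odd m \<and> (m ^ 2 - 1) div 8 = r}"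
proof (rule finite_subset)
  show "{m. m \<ge> 1 \<and> odd m \<and> (m ^ 2 - 1) div 8 = r} \<subseteq> {..8 * r + 8}"
  proof
    fix m assume "m \<in> {m. m \<ge> 1 \<and> odd m \<and> (m ^ 2 - 1) div 8 = r}"
    then have "m ^ 2 \<le> 8 * r + 8" by auto
    moreover have "m \<le> m ^ 2" by (simp add: power2_eq_square)
    ultimately show "m \<in> {..8 * r + 8}" by simp
  qed
qed simp

text \<open>The division by 8 is exact, because \<open>m\<close> is odd.\<close>

definition N_adic :: "two_adic \<Rightarrow> two_adic fps"
  where "N_adic s = Abs_fps (\<lambda>r. \<Sum>m | m \<ge> 1 \<and> odd m \<and> (m ^ 2 - 1) div 8 = r.
    of_int (chi8 m) * of_nat m * pow2 (of_nat (m ^ 2)) s)"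

definition W_adic :: "two_adic \<Rightarrow> two_adic fps"
  where "W_adic s = N_adic s / fps_of_int_fps D_ser"

definition fps_cong_two_powi :: "int \<Rightarrow> two_adic fps \<Rightarrow> two_adic fps \<Rightarrow> bool"
  where "fps_cong_two_powi e F G \<longleftrightarrow> (\<forall>r. cong_two_powi e (fps_nth F r) (fps_nth G r))"

end

theory Submission
  imports Defs
begin

text \<open>
  Every odd square is \<open>v = 1 + 8 * y\<close> with \<open>y\<close> a triangular number, so a coefficient of
  \<^const>\<open>N_adic\<close> is a finite integral combination of powers \<open>v ^ s = exp (s * ln v)\<close> with
  \<open>v \<in> 1 + 8 Z2\<close>. The inverse of \<^const>\<open>D_ser\<close> has integral coefficients, so a coefficient of
  \<^const>\<open>W_adic\<close> is such a combination too. Hence everything reduces to four facts about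
  \<open>v ^ s\<close> for a single \<open>v\<close>: it is a 2-adic integer, it is analytic in \<open>s\<close>, it is the
  usual power for natural numbers \<open>s\<close>, and
  \<open>v ^ s - v ^ t\<close> is \<open>8 * y * (s - t)\<close> times an odd 2-adic integer (lemma \<open>pow2_diff\<close>). The last
  fact gives the congruence. The coefficient of \<open>q\<close> involves only \<open>v = 9\<close>, that is \<open>y = 1\<close>, where
  the difference has valuation exactly \<open>3 + val2 (s - t)\<close>; so the congruence is optimal.

  The facts about \<open>v ^ s\<close> rest on one estimate, that \<open>2 ^ k / (k + 1)!\<close> is a 2-adic integer. With it
  the terms of the exponential series at \<open>8 * y\<close> tend to zero fast enough for convergence, for the
  expansion \<open>exp (8 * y) = 1 + 8 * y + 32 * y ^ 2 * z\<close> with \<open>z\<close> integral (lemma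
  \<open>exp2_quadratic\<close>), and for the addition theorem, by truncation (lemma \<open>exp2_add\<close>).

  The delicate point is \<open>exp (ln v) = v\<close> (lemma \<open>exp2_ln2\<close>), without which natural exponents would
  not give the usual powers. The proof compares \<open>N\<close>-th powers. The binomial theorem gives
  \<open>v ^ N = 1 + N * ln v\<close> modulo \<open>N ^ 2\<close> (lemma \<open>power_ln2\<close>), and the expansion of the exponential
  gives the same for \<open>exp (ln v) ^ N = exp (N * ln v)\<close>. For \<open>N = 2 ^ n\<close> the difference of the two
  powers is a unit times \<open>2 ^ n * (v - exp (ln v))\<close>, so \<open>v - exp (ln v)\<close> is divisible by \<open>2 ^ n\<close>, for
  every \<open>n\<close>.
\<close>

section \<open>Powers of the maximal ideal and convergence\<close>

text \<open>
  Estimates are stated as membership in these ideals rather than through \<^const>\<open>val2\<close>, whose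
  value at \<open>0\<close> would force a case distinction at every step.
\<close>

definition ideal2 :: "nat \<Rightarrow> two_adic set"
  where "ideal2 n = (\<lambda>z. 2 ^ n * z) ` Z2"

lemma ideal2_0 [simp]: "ideal2 0 = Z2"
  by (simp add: ideal2_def)

lemma Z2_0 [simp, intro]: "0 \<in> Z2"
  unfolding Z2_def by (metis of_two_adic_int_simps(1) rangeI)

lemma Z2_of_nat [simp, intro]: "of_nat n \<in> Z2"
  unfolding Z2_def by (metis of_two_adic_int_of_nat rangeI)

lemma Z2_1 [simp, intro]: "1 \<in> Z2"
  using Z2_of_nat [of 1] by simp

lemma Z2_numeral [simp, intro]: "numeral k \<in> Z2"
  using Z2_of_nat [of "numeral k"] by simp

lemma Z2_of_int [simp, intro]: "of_int k \<in> Z2"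
  by (cases k) (auto intro!: Z2_closed simp flip: of_nat_Suc simp del: of_nat_Suc)

lemma Z2_power [intro]: "x \<in> Z2 \<Longrightarrow> x ^ n \<in> Z2"
  by (induction n) (auto intro: Z2_closed)

lemma ideal2I: "z \<in> Z2 \<Longrightarrow> 2 ^ n * z \<in> ideal2 n"
  by (auto simp: ideal2_def)

lemma ideal2E:
  assumes "x \<in> ideal2 n"
  obtains z where "z \<in> Z2" "x = 2 ^ n * z"
  using assms by (auto simp: ideal2_def)

lemma ideal2_closed:
  assumes "x \<in> ideal2 n" "y \<in> ideal2 n"
  shows "x + y \<in> ideal2 n" "x - y \<in> ideal2 n"
  using assms unfolding ideal2_def
  by (auto simp: image_iff simp flip: distrib_left right_diff_distrib intro: Z2_closed)

lemma ideal2_0_mem [simp, intro]: "0 \<in> ideal2 n"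
  using ideal2I [of 0 n] by simp

lemma ideal2_minus: "x \<in> ideal2 n \<Longrightarrow> - x \<in> ideal2 n"
  using ideal2_closed(2) [of 0 n x] by simp

lemma ideal2_minus_commute: "x - y \<in> ideal2 n \<longleftrightarrow> y - x \<in> ideal2 n"
  using ideal2_minus by (metis minus_diff_eq)

lemma ideal2_mult: "x \<in> ideal2 m \<Longrightarrow> y \<in> ideal2 n \<Longrightarrow> x * y \<in> ideal2 (m + n)"
  by (elim ideal2E) (auto simp: ideal2_def power_add mult_ac intro!: image_eqI Z2_closed)

lemma ideal2_mult_Z2: "x \<in> Z2 \<Longrightarrow> y \<in> ideal2 n \<Longrightarrow> x * y \<in> ideal2 n"
  using ideal2_mult [of x 0 y n] by simp

lemma ideal2_antimono: "m \<le> n \<Longrightarrow> ideal2 n \<subseteq> ideal2 m"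
proof
  fix x assume "m \<le> n" "x \<in> ideal2 n"
  then obtain z where "z \<in> Z2" "x = 2 ^ m * (2 ^ (n - m) * z)"
    by (metis (no_types, opaque_lifting) ideal2E le_add_diff_inverse mult.assoc power_add)
  then show "x \<in> ideal2 m" by (auto intro: ideal2I Z2_closed)
qed

lemma ideal2_sum: "(\<And>i. i \<in> A \<Longrightarrow> f i \<in> ideal2 n) \<Longrightarrow> sum f A \<in> ideal2 n"
  by (induction A rule: infinite_finite_induct) (auto intro: ideal2_closed)

lemma Z2_sum: "(\<And>i. i \<in> A \<Longrightarrow> f i \<in> Z2) \<Longrightarrow> sum f A \<in> Z2"
  using ideal2_sum [of A f 0] by simp

lemma ideal2_iff_val2: "x \<in> ideal2 n \<longleftrightarrow> x = 0 \<or> val2 x \<ge> int n"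
  using val2_ge_iff [of x "int n"] by (cases "x = 0") (auto simp: ideal2_def)

lemma ideal2_separated:
  assumes "\<And>n. x \<in> ideal2 n"
  shows "x = 0"
  using assms [of "nat (val2 x + 1)"] by (auto simp: ideal2_iff_val2 split: if_splits)

text \<open>
  \<open>Z2\<close> is a local ring with residue field of two elements, so reduction modulo 2 detects units.
\<close>

lemma unit_odd:
  assumes "x - 1 \<in> ideal2 1"
  obtains y where "y \<in> Z2" "x * y = 1"
proof -
  obtain z where "z \<in> Z2" "x = 1 + 2 * z"
    using assms by (elim ideal2E) (auto simp: algebra_simps)
  then obtain a where a: "x = of_two_adic_int (1 + 2 ^ 1 * a)"
    unfolding Z2_def by auto
  have "residue (1 + 2 ^ 1 * a) 1 \<noteq> 0"
    unfolding plus_two_adic_int.rep_eq residue_two_power_mult one_two_adic_int.rep_eq by simp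
  then obtain b where "(1 + 2 ^ 1 * a) * b = 1" by (rule two_adic_int_unit)
  then have "x * of_two_adic_int b = 1"
    unfolding a by (metis of_two_adic_int_simps(2,6))
  then show thesis by (intro that) (auto simp: Z2_def)
qed

text \<open>
  An integer is determined by its residue modulo any power of 2 that exceeds it. Characteristic
  zero makes the factorials in the exponential series invertible.
\<close>

instance two_adic :: field_char_0
proof
  show "inj (of_nat :: nat \<Rightarrow> two_adic)"
  proof
    fix m n :: nat
    assume "(of_nat m :: two_adic) = of_nat n"
    then have "(of_nat m :: two_adic_int) = of_nat n"
      by (metis of_two_adic_int_eq_iff of_two_adic_int_of_nat)
    then have eq: "int m mod 2 ^ (m + n) = int n mod 2 ^ (m + n)"
      by (metis residue_of_nat)
    have "int m < 2 ^ m" "int n < 2 ^ n" by (rule of_nat_less_two_power)+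
    moreover have "(2 :: int) ^ m \<le> 2 ^ (m + n)" "(2 :: int) ^ n \<le> 2 ^ (m + n)"
      by (simp_all add: power_increasing)
    ultimately have "int m < 2 ^ (m + n)" "int n < 2 ^ (m + n)" by linarith+
    with eq show "m = n" by simp
  qed
qed

text \<open>
  The ideals are a basis of neighbourhoods of \<open>0\<close>. After this lemma the real-valued metric is not
  mentioned any more: convergence is a family of congruences.
\<close>

lemma tendsto_iff_ideal2:
  "(f \<longlongrightarrow> l) F \<longleftrightarrow> (\<forall>n. eventually (\<lambda>x. f x - l \<in> ideal2 n) F)"
proof
  assume L: "(f \<longlongrightarrow> l) F"
  show "\<forall>n. eventually (\<lambda>x. f x - l \<in> ideal2 n) F"
  proof
    fix n
    have "eventually (\<lambda>x. dist (f x) l < 2 powi (1 - int n)) F"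
      using L unfolding tendsto_iff by simp
    then show "eventually (\<lambda>x. f x - l \<in> ideal2 n) F"
    proof (rule eventually_mono)
      fix x assume *: "dist (f x) l < 2 powi (1 - int n)"
      show "f x - l \<in> ideal2 n"
      proof (rule ccontr)
        assume "f x - l \<notin> ideal2 n"
        then have "f x \<noteq> l" "1 - int n \<le> - val2 (f x - l)"
          by (auto simp: ideal2_iff_val2)
        then have "2 powi (1 - int n) \<le> dist (f x) l"
          using power_int_increasing [of "1 - int n" "- val2 (f x - l)" "2::real"]
          by (simp add: dist_two_adic_def abs2_def)
        with * show False by simp
      qed
    qed
  qed
next
  assume R: "\<forall>n. eventually (\<lambda>x. f x - l \<in> ideal2 n) F"
  show "(f \<longlongrightarrow> l) F"
    unfolding tendsto_iff
  proof (intro allI impI)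
    fix e :: real assume "e > 0"
    then obtain n where n: "(1 / 2) ^ n < e"
      using real_arch_pow_inv [of e "1/2"] by auto
    show "eventually (\<lambda>x. dist (f x) l < e) F"
      using R [rule_format, of n]
    proof (rule eventually_mono)
      fix x assume "f x - l \<in> ideal2 n"
      then have "dist (f x) l \<le> 2 powi (- int n)"
        by (auto simp: dist_two_adic_def abs2_def ideal2_iff_val2 intro: power_int_increasing)
      also have "\<dots> = (1 / 2) ^ n" by (simp add: power_int_minus power_divide inverse_eq_divide)
      finally show "dist (f x) l < e" using n by simp
    qed
  qed
qed

text \<open>
  This makes the general rules for shifting and adding convergent series available.
\<close>

instance two_adic :: topological_ab_group_add
proof
  fix a b :: two_adic
  show "((\<lambda>x. fst x + snd x) \<longlongrightarrow> a + b) (nhds a \<times>\<^sub>F nhds b)"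
    unfolding tendsto_iff_ideal2
  proof
    fix n
    have "\<forall>\<^sub>F x in nhds c. x - c \<in> ideal2 n" for c :: two_adic
      using filterlim_ident [of "nhds c"] unfolding tendsto_iff_ideal2 by blast
    then have "\<forall>\<^sub>F x in nhds a \<times>\<^sub>F nhds b. fst x - a \<in> ideal2 n \<and> snd x - b \<in> ideal2 n"
      by (intro eventually_prodI)
    then show "eventually (\<lambda>x. fst x + snd x - (a + b) \<in> ideal2 n) (nhds a \<times>\<^sub>F nhds b)"
    proof eventually_elim
      case (elim x)
      then show ?case using ideal2_closed(1) [of "fst x - a" n "snd x - b"] elim by (simp add: algebra_simps)
    qed
  qed
  have "((\<lambda>x. x) \<longlongrightarrow> a) (nhds a)" by (rule filterlim_ident)
  then show "(uminus \<longlongrightarrow> - a) (nhds a)"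
    unfolding tendsto_iff_ideal2 by (simp add: ideal2_minus_commute add.commute)
qed

text \<open>
  Multiplication by a 2-adic integer preserves each ideal, hence is continuous.
\<close>

lemma sums_cmult_Z2:
  assumes "c \<in> Z2" "f sums S"
  shows "(\<lambda>k. c * f k) sums (c * S)"
  unfolding sums_def tendsto_iff_ideal2
proof
  fix n
  have "\<forall>\<^sub>F K in sequentially. sum f {..<K} - S \<in> ideal2 n"
    using assms(2) unfolding sums_def tendsto_iff_ideal2 by blast
  then show "\<forall>\<^sub>F K in sequentially. (\<Sum>k<K. c * f k) - c * S \<in> ideal2 n"
    by (rule eventually_mono)
      (use assms(1) ideal2_mult_Z2 in \<open>auto simp flip: sum_distrib_left right_diff_distrib\<close>)
qed

text \<open>
  The ultrametric principle: a tail whose terms all lie in the ideal sums to an element of the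
  ideal, because the ideal is a subgroup and is closed. It turns termwise divisibility into a
  congruence for the sum.
\<close>

lemma sums_tail_ideal2:
  assumes "f sums S" "\<And>k. k \<ge> K \<Longrightarrow> f k \<in> ideal2 n"
  shows "S - sum f {..<K} \<in> ideal2 n"
proof -
  have "\<forall>\<^sub>F k in sequentially. sum f {..<k} - S \<in> ideal2 n"
    using assms(1) unfolding sums_def tendsto_iff_ideal2 by blast
  moreover have "\<forall>\<^sub>F k in sequentially. k \<ge> K" by (rule eventually_ge_at_top)
  ultimately have "\<forall>\<^sub>F k in sequentially. sum f {..<k} - S \<in> ideal2 n \<and> k \<ge> K"
    by (rule eventually_conj)
  then obtain k where k: "sum f {..<k} - S \<in> ideal2 n" "k \<ge> K"
    by (auto simp: eventually_sequentially)
  have "sum f {..<k} - sum f {..<K} = sum f {K..<k}"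
    using k(2) by (metis lessThan_atLeast0 sum_diff_nat_ivl zero_le)
  also have "\<dots> \<in> ideal2 n" by (rule ideal2_sum) (use assms(2) in simp)
  finally show ?thesis using ideal2_closed(2) [OF _ k(1)] by fastforce
qed

lemma sums_Z2: "f sums S \<Longrightarrow> (\<And>k. f k \<in> Z2) \<Longrightarrow> S \<in> Z2"
  using sums_tail_ideal2 [of f S 0 0] by simp

text \<open>
  The \<open>n\<close>-th partial sum already has the right residue modulo \<open>2 ^ n\<close>, so these residues form a
  coherent sequence, that is, a point of the inverse limit.
\<close>

lemma two_adic_int_complete:
  fixes g :: "nat \<Rightarrow> two_adic_int"
  obtains x where "\<And>n. residue x n = residue (\<Sum>k<n. 2 ^ k * g k) n"
proof -
  let ?r = "\<lambda>n. residue (\<Sum>k<n. 2 ^ k * g k) n"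
  have "?r (Suc n) mod 2 ^ n = ?r n" for n
  proof -
    have "?r (Suc n) mod 2 ^ n = residue (\<Sum>k<Suc n. 2 ^ k * g k) n"
      by (rule residue_mod_le) simp
    also have "\<dots> = ?r n"
      by (simp add: plus_two_adic_int.rep_eq residue_two_power_mult residue_mod_le)
    finally show ?thesis .
  qed
  then have "residue (Abs_two_adic_int ?r) = ?r"
    by (intro Abs_two_adic_int_inverse) blast
  then show thesis by (intro that [of "Abs_two_adic_int ?r"]) simp
qed

lemma summable_ideal2:
  assumes "\<And>k. f k \<in> ideal2 k"
  shows "summable f"
proof -
  have "\<exists>g. f k = of_two_adic_int (2 ^ k * g)" for k
    using assms [of k] by (auto simp: ideal2_def Z2_def)
  then obtain g where g: "\<And>k. f k = of_two_adic_int (2 ^ k * g k)" by metis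
  obtain x where x: "\<And>n. residue x n = residue (\<Sum>k<n. 2 ^ k * g k) n"
    using two_adic_int_complete by blast
  have part: "sum f {..<K} = of_two_adic_int (\<Sum>k<K. 2 ^ k * g k)" for K
    by (induction K) (simp_all add: g)
  have "sum f {..<n} - of_two_adic_int x \<in> ideal2 n" for n
  proof -
    have "residue ((\<Sum>k<n. 2 ^ k * g k) - x) n = 0"
      unfolding minus_two_adic_int.rep_eq x by simp
    then obtain b where "(\<Sum>k<n. 2 ^ k * g k) - x = 2 ^ n * b"
      by (rule two_adic_int_divide) blast
    then have "sum f {..<n} - of_two_adic_int x = of_two_adic_int (2 ^ n * b)"
      unfolding part by (metis of_two_adic_int_simps(4))
    then show ?thesis by (simp add: ideal2_def Z2_def)
  qed
  then have "f sums of_two_adic_int x"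
    unfolding sums_def tendsto_iff_ideal2 eventually_sequentially
    using ideal2_antimono by blast
  then show ?thesis by (rule sums_summable)
qed

section \<open>The exponential and the logarithm\<close>

lemma inverse_odd_Z2:
  assumes "odd d"
  shows "1 / of_nat d \<in> Z2"
proof -
  obtain c where "d = 2 * c + 1" using assms by (rule oddE)
  then have "of_nat d - 1 = 2 ^ 1 * (of_nat c :: two_adic)" by simp
  then have "(of_nat d - 1 :: two_adic) \<in> ideal2 1" using ideal2I by (metis Z2_of_nat)
  then obtain y where y: "y \<in> Z2" "of_nat d * y = 1" by (rule unit_odd)
  then have "1 / of_nat d = y" by (metis mult_zero_left nonzero_eq_divide_eq mult.commute zero_neq_one)
  with y show ?thesis by simp
qed

text \<open>
  The even factors of \<open>(2 m)!\<close> contribute \<open>2 ^ m * m!\<close>, the others the odd number \<open>e\<close>.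
\<close>

lemma fact_double: "\<exists>e. odd e \<and> fact (2 * m) = (2 ^ m * fact m * e :: nat)"
proof (induction m)
  case (Suc m)
  then obtain e :: nat where e: "odd e" "fact (2 * m) = 2 ^ m * fact m * e" by blast
  have "fact (2 * Suc m) = (2 * Suc m) * ((2 * m + 1) * fact (2 * m) :: nat)" by simp
  also have "\<dots> = 2 ^ Suc m * fact (Suc m) * ((2 * m + 1) * e)"
    unfolding e(2) by (simp only: fact_Suc power_Suc of_nat_id mult_ac)
  finally show ?case using e(1) by (metis even_mult_iff odd_two_times_div_two_succ dvd_triv_left even_plus_one_iff)
qed (auto intro: exI [of _ 1])

text \<open>
  The strict bound on the exponent is sharp at powers of two. Halving \<open>n\<close> with
  \<open>fact_double\<close> adds \<open>n div 2\<close> to an exponent that is less than \<open>n div 2\<close>.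
\<close>

lemma fact_two_part:
  assumes "n > 0"
  shows "\<exists>j d. fact n = (2 ^ j * d :: nat) \<and> odd d \<and> j < n"
  using assms
proof (induction n rule: less_induct)
  case (less n)
  define m where "m = n div 2"
  show ?case
  proof (cases "n = 1")
    case True
    then show ?thesis by (intro exI [of _ 0] exI [of _ 1]) auto
  next
    case False
    then have m: "m > 0" "m < n" using less.prems by (auto simp: m_def)
    then obtain j d :: nat where d: "fact m = 2 ^ j * d" "odd d" "j < m"
      using less.IH by blast
    obtain e :: nat where e: "odd e" "fact (2 * m) = 2 ^ m * fact m * e"
      using fact_double by blast
    have 2: "fact (2 * m) = 2 ^ (m + j) * (d * e)"
      unfolding e(2) d(1) power_add by (simp only: mult_ac)
    show ?thesis
    proof (cases "even n")
      case True
      then have "n = 2 * m" by (simp add: m_def)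
      with 2 d e show ?thesis by (intro exI [of _ "m + j"] exI [of _ "d * e"]) auto
    next
      case False
      then have n: "n = Suc (2 * m)" by (simp add: m_def)
      have "fact n = n * fact (2 * m)" unfolding n by (simp only: fact_Suc of_nat_id)
      also have "\<dots> = 2 ^ (m + j) * (n * d * e)" unfolding 2 by (simp only: mult_ac)
      finally have "fact n = 2 ^ (m + j) * (n * d * e)" .
      with n d e False show ?thesis by (intro exI [of _ "m + j"] exI [of _ "n * d * e"]) auto
    qed
  qed
qed

lemma two_power_div_fact_Z2: "2 ^ k / fact (Suc k) \<in> Z2"
proof -
  obtain j d :: nat where d: "fact (Suc k) = 2 ^ j * d" "odd d" "j < Suc k"
    using fact_two_part [of "Suc k"] by blast
  have "(fact (Suc k) :: two_adic) = of_nat (fact (Suc k))" by (rule of_nat_fact [symmetric])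
  also have "\<dots> = 2 ^ j * of_nat d" unfolding d(1) by simp
  finally have "2 ^ k / fact (Suc k) = 2 ^ k / 2 ^ j * (1 / of_nat d :: two_adic)" by simp
  also have "\<dots> = 2 ^ (k - j) * (1 / of_nat d)" using d(3) by (simp add: power_diff)
  also have "\<dots> \<in> Z2" using d(2) by (intro Z2_closed Z2_power inverse_odd_Z2) auto
  finally show ?thesis .
qed

text \<open>
  The factor \<open>8 ^ k\<close> gives \<open>3 k\<close> powers of 2, of which \<open>k!\<close> cancels at most \<open>k\<close>.
\<close>

lemma exp_term_ideal2:
  assumes "x \<in> ideal2 3"
  shows "x ^ k / fact k \<in> ideal2 (2 * k)"
proof (cases k)
  case (Suc n)
  obtain z where z: "z \<in> Z2" "x = 8 * z" using assms by (elim ideal2E) simp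
  have "x ^ k = 4 ^ k * (2 * 2 ^ n * z ^ k)"
    unfolding z(2) power_mult_distrib [of 8 z k] Suc power_Suc [of 2 n, symmetric]
    by (simp add: power_mult_distrib flip: power_mult_distrib [of 4 2] )
  then have "x ^ k / fact k = 2 ^ (2 * k) * (2 * (2 ^ n / fact (Suc n)) * z ^ k)"
    by (simp add: Suc power_mult)
  also have "\<dots> \<in> ideal2 (2 * k)"
    using z two_power_div_fact_Z2 [of n] by (intro ideal2I Z2_closed Z2_power) auto
  finally show ?thesis .
qed simp

lemma exp2_sums:
  assumes "x \<in> ideal2 3"
  shows "(\<lambda>k. x ^ k / fact k) sums exp2 x"
proof -
  have "x ^ k / fact k \<in> ideal2 k" for k
    using exp_term_ideal2 [OF assms, of k] ideal2_antimono [of k "2 * k"] by auto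
  then show ?thesis unfolding exp2_def of_nat_fact by (intro summable_sums summable_ideal2)
qed

text \<open>
  The second-order expansion, uniform in \<open>y\<close>. From degree 2 on the terms are
  \<open>32 * y ^ 2\<close> times 2-adic integers: of the factor \<open>8 ^ (k + 2)\<close>, a part \<open>2 ^ (k + 1)\<close> is needed
  for the denominator \<open>(k + 2)!\<close>, and \<open>32 * 4 ^ k\<close> is left over.
\<close>

lemma exp2_quadratic:
  assumes "y \<in> Z2"
  obtains z where "z \<in> Z2" "exp2 (8 * y) = 1 + 8 * y + 32 * y ^ 2 * z"
proof -
  define g where "g k = 2 ^ k * (2 ^ k * y ^ k * (2 ^ Suc k / fact (Suc (Suc k))))" for k
  have g: "g k \<in> ideal2 k" for k
    unfolding g_def
    using two_power_div_fact_Z2 [of "Suc k"] assms by (intro ideal2I Z2_closed Z2_power) auto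
  have c: "32 * y ^ 2 \<in> Z2" using assms by (intro Z2_closed) auto
  have "(8 * y) ^ Suc (Suc k) / fact (Suc (Suc k)) = 32 * y ^ 2 * g k" for k
  proof -
    have "(8 * y) ^ Suc (Suc k) = 32 * y ^ 2 * (2 ^ k * (2 ^ k * y ^ k * 2 ^ Suc k))"
    proof -
      have "(8::two_adic) ^ k = 2 ^ k * (2 ^ k * 2 ^ k)"
        by (simp flip: power_mult_distrib)
      then show ?thesis by (simp add: power_mult_distrib power2_eq_square mult_ac)
    qed
    then show ?thesis unfolding g_def by (simp only: times_divide_eq_right)
  qed
  moreover have "(\<lambda>k. 32 * y ^ 2 * g k) sums (32 * y ^ 2 * suminf g)"
    using summable_ideal2 [OF g] by (intro sums_cmult_Z2 c summable_sums)
  ultimately have "(\<lambda>k. (8 * y) ^ Suc (Suc k) / fact (Suc (Suc k))) sums (32 * y ^ 2 * suminf g)"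
    by simp
  from sums_Suc [OF sums_Suc [OF this]]
  have "(\<lambda>k. (8 * y) ^ k / fact k) sums (1 + 8 * y + 32 * y ^ 2 * suminf g)"
    by (simp add: add_ac)
  moreover have "8 * y \<in> ideal2 3" using ideal2I [OF assms, of 3] by simp
  ultimately have "exp2 (8 * y) = 1 + 8 * y + 32 * y ^ 2 * suminf g"
    using exp2_sums sums_unique2 by blast
  moreover have "suminf g \<in> Z2"
  proof (rule sums_Z2)
    show "g sums suminf g" using summable_ideal2 [OF g] by (rule summable_sums)
    show "g k \<in> Z2" for k using g [of k] ideal2_antimono [of 0 k] by auto
  qed
  ultimately show thesis by (rule that [rotated])
qed

lemma exp2_0 [simp]: "exp2 0 = 1"
  using exp2_quadratic [of 0] by (metis Z2_0 add.right_neutral mult_zero_left mult_zero_right power_zero_numeral)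

lemma exp2_one_unit:
  assumes "x \<in> ideal2 3"
  shows "exp2 x - 1 \<in> ideal2 3"
proof -
  obtain y where y: "y \<in> Z2" "x = 8 * y" using assms by (elim ideal2E) simp
  obtain z where z: "z \<in> Z2" "exp2 x = 1 + 8 * y + 32 * y ^ 2 * z"
    using exp2_quadratic y by metis
  have "exp2 x - 1 = 2 ^ 3 * (y + 4 * y ^ 2 * z)" unfolding z(2) by (simp add: algebra_simps)
  also have "\<dots> \<in> ideal2 3" using y z by (intro ideal2I Z2_closed Z2_power) auto
  finally show ?thesis .
qed

text \<open>
  Modulo \<open>2 ^ K\<close> all series may be truncated at \<open>K\<close>. By the binomial theorem the truncated series of
  \<open>x + y\<close> is the sum over the triangle \<open>i + j < K\<close>, while the product of the truncated series is
  the sum over the square. The terms outside the triangle vanish modulo \<open>2 ^ K\<close>.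
\<close>

lemma exp2_add:
  assumes x: "x \<in> ideal2 3" and y: "y \<in> ideal2 3"
  shows "exp2 (x + y) = exp2 x * exp2 y"
proof -
  let ?e = "\<lambda>x k. x ^ k / fact k :: two_adic"
  let ?S = "\<lambda>x K. sum (?e x) {..<K}"
  have xy: "x + y \<in> ideal2 3" using x y by (rule ideal2_closed)
  have e: "?e x k \<in> ideal2 k" if "x \<in> ideal2 3" for x k
    using exp_term_ideal2 [OF that, of k] ideal2_antimono [of k "2 * k"] by auto
  then have e0: "?e x k \<in> Z2" if "x \<in> ideal2 3" for x k
    using that ideal2_antimono [of 0 k] by fastforce
  have conv: "exp2 x - ?S x K \<in> ideal2 K" if "x \<in> ideal2 3" for x K
    using e [OF that] ideal2_antimono
    by (intro sums_tail_ideal2 exp2_sums that) blast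
  have conv': "?S x K - exp2 x \<in> ideal2 K" if "x \<in> ideal2 3" for x K
    using conv [OF that] by (simp add: ideal2_minus_commute)
  have binom: "?e (x + y) k = (\<Sum>i\<le>k. ?e x i * ?e y (k - i))" for k
  proof -
    have "?e (x + y) k = (\<Sum>i\<le>k. of_nat (k choose i) * x ^ i * y ^ (k - i) / fact k)"
      by (simp add: binomial_ring sum_divide_distrib)
    also have "\<dots> = (\<Sum>i\<le>k. ?e x i * ?e y (k - i))"
      by (rule sum.cong) (simp_all add: binomial_fact)
    finally show ?thesis .
  qed
  have "exp2 (x + y) - exp2 x * exp2 y \<in> ideal2 K" for K
  proof -
    let ?T = "{(i, j). i + j < K}" and ?Q = "{..<K} \<times> {..<K}"
    have "?S (x + y) K = (\<Sum>(i, j)\<in>?T. ?e x i * ?e y j)"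
      unfolding binom by (rule sum.triangle_reindex [symmetric])
    moreover have "?S x K * ?S y K = (\<Sum>(i, j)\<in>?Q. ?e x i * ?e y j)"
      by (simp only: sum_product sum.cartesian_product)
    moreover have "(\<Sum>(i, j)\<in>?Q. ?e x i * ?e y j) =
        (\<Sum>(i, j)\<in>?Q - ?T. ?e x i * ?e y j) + (\<Sum>(i, j)\<in>?T. ?e x i * ?e y j)"
      by (rule sum.subset_diff) auto
    moreover have "(\<Sum>(i, j)\<in>?Q - ?T. ?e x i * ?e y j) \<in> ideal2 K"
    proof (rule ideal2_sum)
      fix p assume "p \<in> ?Q - ?T"
      then obtain i j where p: "p = (i, j)" "i + j \<ge> K" by (auto simp: not_less)
      then show "(case p of (i, j) \<Rightarrow> ?e x i * ?e y j) \<in> ideal2 K"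
        using ideal2_mult [OF e [OF x, of i] e [OF y, of j]] ideal2_antimono [of K "i + j"] by auto
    qed
    ultimately have 1: "?S x K * ?S y K - ?S (x + y) K \<in> ideal2 K" by simp
    \<comment> \<open>The truncation error of the product, split as \<open>a b - a' b' = (a - a') b + a' (b - b')\<close>.\<close>
    have 2: "(exp2 x - ?S x K) * exp2 y \<in> ideal2 K"
      using ideal2_mult [OF conv [OF x], of "exp2 y" 0 K] exp2_sums [OF y] e0 [OF y] sums_Z2
      by fastforce
    have 3: "?S x K * (exp2 y - ?S y K) \<in> ideal2 K"
      using e0 [OF x] by (intro ideal2_mult_Z2 Z2_sum conv [OF y])
    have "exp2 (x + y) - exp2 x * exp2 y = (exp2 (x + y) - ?S (x + y) K)
        - (?S x K * ?S y K - ?S (x + y) K) - (exp2 x - ?S x K) * exp2 y - ?S x K * (exp2 y - ?S y K)"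
      by (simp only: algebra_simps)
    also have "\<dots> \<in> ideal2 K" by (intro ideal2_closed conv [OF xy] 1 2 3)
    finally show ?thesis .
  qed
  then show ?thesis using ideal2_separated by (metis eq_iff_diff_eq_0)
qed

lemma exp2_of_nat_mult:
  assumes "x \<in> ideal2 3"
  shows "exp2 (of_nat N * x) = exp2 x ^ N"
proof (induction N)
  case (Suc N)
  have "of_nat N * x \<in> ideal2 3" using assms by (intro ideal2_mult_Z2) auto
  then have "exp2 (x + of_nat N * x) = exp2 x * exp2 (of_nat N * x)" by (intro exp2_add assms)
  then show ?case using Suc by (simp add: algebra_simps)
qed simp

text \<open>
  A denominator \<open>k + 1\<close> divides \<open>(k + 1)!\<close>, so the bound on factorials also controls the logarithm.
\<close>

lemma ln_term_ideal2:
  assumes "y \<in> Z2"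
  shows "(- 1) ^ k * (8 * y) ^ k / of_nat (Suc k) \<in> ideal2 k"
proof -
  have "(8::two_adic) ^ k = 2 ^ k * (2 ^ k * 2 ^ k)" by (simp flip: power_mult_distrib)
  moreover have "1 / of_nat (Suc k) = fact k / (fact (Suc k) :: two_adic)" by simp
  ultimately have "(- 1) ^ k * (8 * y) ^ k / of_nat (Suc k) =
      2 ^ k * ((- 1) ^ k * 2 ^ k * y ^ k * fact k * (2 ^ k / fact (Suc k)))"
    by (simp add: power_mult_distrib mult_ac del: of_nat_Suc)
  also have "\<dots> \<in> ideal2 k"
    using two_power_div_fact_Z2 [of k] assms Z2_of_nat [of "fact k"] Z2_of_int [of "-1"]
    by (intro ideal2I Z2_closed Z2_power) auto
  finally show ?thesis .
qed

text \<open>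
  After the factor \<open>8 * y\<close> is taken out, the leading term is 1 and the others are even. In particular
  \<open>ln2 (1 + 8 * y)\<close> has the same valuation as \<open>8 * y\<close>.
\<close>

lemma ln2_sums:
  assumes "y \<in> Z2"
  obtains z where "z \<in> Z2" "ln2 (1 + 8 * y) = 8 * y * (1 + 2 * z)"
    "(\<lambda>k. (- 1) ^ k * (8 * y) ^ Suc k / of_nat (Suc k)) sums ln2 (1 + 8 * y)"
proof -
  let ?h = "\<lambda>k. (- 1) ^ k * (8 * y) ^ k / of_nat (Suc k)"
  have h: "?h k \<in> ideal2 k" for k using ln_term_ideal2 [OF assms] .
  have sums: "?h sums suminf ?h" using summable_ideal2 [OF h] by (rule summable_sums)
  have "suminf ?h - sum ?h {..<1} \<in> ideal2 1"
    using h ideal2_antimono by (intro sums_tail_ideal2 sums) blast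
  then obtain z where z: "z \<in> Z2" "suminf ?h = 1 + 2 * z"
    by (elim ideal2E) (simp add: algebra_simps)
  have "(\<lambda>k. (8 * y) * ?h k) sums ((8 * y) * suminf ?h)"
    using assms by (intro sums_cmult_Z2 sums Z2_closed) auto
  also have "(\<lambda>k. (8 * y) * ?h k) = (\<lambda>k. (- 1) ^ k * (8 * y) ^ Suc k / of_nat (Suc k))"
    by (simp add: mult_ac del: of_nat_Suc)
  finally have *: "(\<lambda>k. (- 1) ^ k * (8 * y) ^ Suc k / of_nat (Suc k)) sums (8 * y * (1 + 2 * z))"
    unfolding z(2) .
  then have "ln2 (1 + 8 * y) = 8 * y * (1 + 2 * z)"
    unfolding ln2_def by (simp add: sums_iff del: of_nat_Suc)
  with * have "(\<lambda>k. (- 1) ^ k * (8 * y) ^ Suc k / of_nat (Suc k)) sums ln2 (1 + 8 * y)"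
    by (simp only:)
  with z(1) \<open>ln2 (1 + 8 * y) = 8 * y * (1 + 2 * z)\<close> show thesis by (rule that)
qed

text \<open>
  Modulo \<open>N\<close>, the numerator of the binomial coefficient \<open>N - 1 choose k\<close> is that of
  \<open>- 1 gchoose k\<close>.
\<close>

lemma prod_shift_mod:
  fixes N :: nat
  shows "\<exists>Q. (\<Prod>i<k. int N - int (Suc i)) = (- 1) ^ k * fact k + int N * Q"
proof (induction k)
  case (Suc k)
  then obtain Q where Q: "(\<Prod>i<k. int N - int (Suc i)) = (- 1) ^ k * fact k + int N * Q" by blast
  have "(\<Prod>i<Suc k. int N - int (Suc i)) =
      (- 1) ^ Suc k * fact (Suc k) + int N * ((- 1) ^ k * fact k + Q * (int N - int (Suc k)))"
    unfolding prod.lessThan_Suc Q by (simp add: algebra_simps)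
  then show ?case by blast
qed (auto intro: exI [of _ 0])

text \<open>
  This is a quantitative form of the limit \<open>ln v = lim (v ^ N - 1) / N\<close> for \<open>N\<close> tending to \<open>0\<close>
  2-adically. In \<open>(N choose k + 1) = N / (k + 1)! * (N - 1) * \<dots> * (N - k)\<close> the product is
  \<open>(- 1) ^ k * k!\<close> modulo \<open>N\<close>; the main part yields \<open>N\<close> times the terms of the logarithm, and the
  error is a multiple of \<open>N ^ 2\<close>, since \<open>8 ^ (k + 1) / (k + 1)!\<close> is integral.
\<close>

lemma power_ln2:
  assumes "y \<in> Z2"
  obtains z where "z \<in> Z2" "(1 + 8 * y) ^ N = 1 + of_nat N * ln2 (1 + 8 * y) + of_nat N ^ 2 * z"
proof -
  define u where "u = 8 * y"
  have u: "u \<in> ideal2 3" using ideal2I [OF assms, of 3] by (simp add: u_def)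
  obtain Q where Q: "\<And>k. (\<Prod>i<k. int N - int (Suc i)) = (- 1) ^ k * fact k + int N * Q k"
    using prod_shift_mod by metis
  define q where "q k = of_int (Q k) * (u ^ Suc k / fact (Suc k))" for k
  have q: "q k \<in> ideal2 k" for k
    using ideal2_mult_Z2 [OF Z2_of_int exp_term_ideal2 [OF u, of "Suc k"], of "Q k"]
      ideal2_antimono [of k "2 * Suc k"] by (auto simp: q_def)
  have q0: "q k \<in> Z2" for k using q [of k] ideal2_antimono [of 0 k] by auto
  have qs: "q sums suminf q" using summable_ideal2 [OF q] by (rule summable_sums)
  let ?b = "\<lambda>k. of_nat (N choose Suc k) * u ^ Suc k :: two_adic"
  let ?l = "\<lambda>k. (- 1) ^ k * u ^ Suc k / of_nat (Suc k)"
  have eq: "?b k = of_nat N * ?l k + of_nat N ^ 2 * q k" for k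
  proof -
    have alg: "n * (s * f + n * r) / F * U = n * (s * U * (f / F)) + n ^ 2 * (r * (U / F))"
      for n s f r F U :: two_adic
      by (simp add: add_divide_distrib algebra_simps power2_eq_square)
    have "fact (Suc k) * (of_nat (N choose Suc k) :: two_adic) = (\<Prod>i<Suc k. of_nat N - of_nat i)"
      unfolding binomial_gbinomial gbinomial_mult_fact by (simp only: atLeast0LessThan)
    also have "\<dots> = of_nat N * (\<Prod>i<k. of_nat N - of_nat (Suc i))"
      by (simp only: prod.lessThan_Suc_shift of_nat_0 diff_zero)
    also have "(\<Prod>i<k. of_nat N - of_nat (Suc i)) = (of_int (\<Prod>i<k. int N - int (Suc i)) :: two_adic)"
      by (simp only: of_int_prod of_int_diff of_int_of_nat_eq)
    also have "\<dots> = (- 1) ^ k * fact k + of_nat N * of_int (Q k)"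
      unfolding Q by simp
    finally have "of_nat (N choose Suc k) =
        (of_nat N * ((- 1) ^ k * fact k + of_nat N * of_int (Q k))) / (fact (Suc k) :: two_adic)"
      by (metis fact_nonzero nonzero_mult_div_cancel_left)
    then have "?b k = of_nat N * ((- 1) ^ k * u ^ Suc k * (fact k / fact (Suc k)))
        + of_nat N ^ 2 * q k"
      unfolding q_def by (simp only: alg)
    also have "fact k / fact (Suc k) = (1 / of_nat (Suc k) :: two_adic)" by simp
    finally show ?thesis by simp
  qed
  have "?b sums (\<Sum>k<N. ?b k)" by (rule sums_finite) simp_all
  also have "(\<Sum>k<N. ?b k) = (1 + u) ^ N - 1"
    using binomial_ring [of u 1 N] by (simp add: sum.atMost_shift add.commute)
  finally have b: "?b sums ((1 + u) ^ N - 1)" .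
  have "?l sums ln2 (1 + 8 * y)"
    unfolding u_def using ln2_sums [OF assms] by blast
  then have "?b sums (of_nat N * ln2 (1 + 8 * y) + of_nat N ^ 2 * suminf q)"
    unfolding eq by (intro sums_add sums_cmult_Z2 qs Z2_power) auto
  then have "(1 + u) ^ N - 1 = of_nat N * ln2 (1 + 8 * y) + of_nat N ^ 2 * suminf q"
    using b sums_unique2 by blast
  then show thesis
    using sums_Z2 [OF qs q0] by (intro that [of "suminf q"]) (simp_all add: u_def algebra_simps)
qed

lemma one_unit_Z2:
  assumes "a - 1 \<in> ideal2 n"
  shows "a \<in> Z2"
proof -
  have "a - 1 \<in> Z2" using assms ideal2_antimono [of 0 n] by auto
  then show ?thesis using Z2_closed(1) [of "a - 1" 1] by simp
qed

lemma one_unit_mult: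
  assumes "a - 1 \<in> ideal2 n" "b - 1 \<in> ideal2 n"
  shows "a * b - 1 \<in> ideal2 n"
proof -
  have "a \<in> Z2" using assms(1) by (rule one_unit_Z2)
  then have "a * (b - 1) + (a - 1) \<in> ideal2 n"
    using assms by (intro ideal2_closed(1) [of _ n] ideal2_mult_Z2)
  then show ?thesis by (simp add: algebra_simps)
qed

lemma one_unit_power: "a - 1 \<in> ideal2 n \<Longrightarrow> a ^ k - 1 \<in> ideal2 n"
  by (induction k) (auto intro: one_unit_mult)

text \<open>
  Squaring two elements of \<open>1 + 8 Z2\<close> multiplies their difference by \<open>a + b\<close>, which is twice a unit.
  So \<open>a ^ 2 ^ n - b ^ 2 ^ n\<close> is no more divisible by 2 than \<open>2 ^ n * (a - b)\<close>; the factor \<open>c\<close>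
  collects the inverses of the units.
\<close>

lemma power_two_power_diff:
  assumes a: "a - 1 \<in> ideal2 3" and b: "b - 1 \<in> ideal2 3"
  obtains c where "c \<in> Z2" "c * (a ^ 2 ^ n - b ^ 2 ^ n) = 2 ^ n * (a - b)"
proof -
  have "\<exists>c\<in>Z2. c * (a ^ 2 ^ n - b ^ 2 ^ n) = 2 ^ n * (a - b)"
  proof (induction n)
    case (Suc n)
    then obtain c where c: "c \<in> Z2" "c * (a ^ 2 ^ n - b ^ 2 ^ n) = 2 ^ n * (a - b)" by blast
    obtain x where x: "x \<in> Z2" "a ^ 2 ^ n = 1 + 8 * x"
      using one_unit_power [OF a, of "2 ^ n"] by (elim ideal2E) (simp add: algebra_simps)
    obtain y where y: "y \<in> Z2" "b ^ 2 ^ n = 1 + 8 * y"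
      using one_unit_power [OF b, of "2 ^ n"] by (elim ideal2E) (simp add: algebra_simps)
    have "2 ^ 1 * (2 * x + 2 * y) \<in> ideal2 1" using x y by (intro ideal2I Z2_closed) auto
    then have "(1 + 4 * x + 4 * y) - 1 \<in> ideal2 1" by (simp add: algebra_simps)
    then obtain e where e: "e \<in> Z2" "(1 + 4 * x + 4 * y) * e = 1" by (rule unit_odd)
    have "a ^ 2 ^ Suc n - b ^ 2 ^ Suc n = (a ^ 2 ^ n - b ^ 2 ^ n) * (a ^ 2 ^ n + b ^ 2 ^ n)"
      unfolding power_Suc mult_2 power_add by (simp add: algebra_simps)
    also have "a ^ 2 ^ n + b ^ 2 ^ n = 2 * (1 + 4 * x + 4 * y)"
      unfolding x y by (simp add: algebra_simps)
    finally have "c * e * (a ^ 2 ^ Suc n - b ^ 2 ^ Suc n) =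
        2 * (c * (a ^ 2 ^ n - b ^ 2 ^ n)) * ((1 + 4 * x + 4 * y) * e)"
      by (simp only: mult_ac)
    also have "\<dots> = 2 ^ Suc n * (a - b)" unfolding c(2) e(2) by (simp add: mult_ac)
    finally show ?case using c(1) e(1) by (intro bexI [of _ "c * e"] Z2_closed)
  qed (auto intro: bexI [of _ 1])
  then show thesis using that by blast
qed

text \<open>
  Compare \<open>N\<close>-th powers: with \<open>v = 1 + 8 * y\<close> and \<open>L = ln2 v\<close>, both \<open>v ^ N\<close> and
  \<open>exp2 L ^ N = exp2 (N * L)\<close> are \<open>1 + N * L\<close> modulo \<open>N ^ 2\<close>. For \<open>N = 2 ^ n\<close> their difference
  is thus divisible by \<open>2 ^ (2 * n)\<close>, although passing to the powers gained only \<open>2 ^ n\<close>. So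
  \<open>v - exp2 L\<close> is divisible by \<open>2 ^ n\<close> for all \<open>n\<close>.
\<close>

lemma exp2_ln2:
  assumes "y \<in> Z2"
  shows "exp2 (ln2 (1 + 8 * y)) = 1 + 8 * y"
proof -
  let ?a = "1 + 8 * y" and ?b = "exp2 (ln2 (1 + 8 * y))"
  obtain w where w: "w \<in> Z2" "ln2 ?a = 8 * w"
  proof -
    obtain z where "z \<in> Z2" "ln2 ?a = 8 * y * (1 + 2 * z)" using ln2_sums [OF assms] by metis
    then show thesis using assms by (intro that [of "y * (1 + 2 * z)"]) (auto intro!: Z2_closed)
  qed
  have ln: "ln2 ?a \<in> ideal2 3" using ideal2I [OF w(1), of 3] w(2) by simp
  have a: "?a - 1 \<in> ideal2 3" using ideal2I [OF assms, of 3] by simp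
  have b: "?b - 1 \<in> ideal2 3" using ln by (rule exp2_one_unit)
  have "?a - ?b \<in> ideal2 n" for n
  proof -
    let ?N = "2 ^ n :: nat"
    obtain c where c: "c \<in> Z2" "c * (?a ^ ?N - ?b ^ ?N) = 2 ^ n * (?a - ?b)"
      using power_two_power_diff [OF a b] by blast
    obtain z where z: "z \<in> Z2" "?a ^ ?N = 1 + of_nat ?N * ln2 ?a + of_nat ?N ^ 2 * z"
      using power_ln2 [OF assms] by blast
    have "of_nat ?N * w \<in> Z2" using w by (intro Z2_closed) auto
    then obtain z' where z': "z' \<in> Z2"
      "exp2 (8 * (of_nat ?N * w)) = 1 + 8 * (of_nat ?N * w) + 32 * (of_nat ?N * w) ^ 2 * z'"
      by (rule exp2_quadratic)
    have "?b ^ ?N = exp2 (of_nat ?N * ln2 ?a)" by (rule exp2_of_nat_mult [OF ln, symmetric])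
    also have "of_nat ?N * ln2 ?a = 8 * (of_nat ?N * w)" unfolding w(2) by (simp only: mult_ac)
    finally have "?a ^ ?N - ?b ^ ?N = of_nat ?N ^ 2 * (z - 32 * w ^ 2 * z')"
      unfolding z z' w(2) by (simp add: algebra_simps power_mult_distrib)
    then have "2 ^ n * (?a - ?b) = 2 ^ n * (2 ^ n * (c * (z - 32 * w ^ 2 * z')))"
      unfolding c(2) [symmetric] by (simp add: power2_eq_square mult_ac)
    then have "?a - ?b = 2 ^ n * (c * (z - 32 * w ^ 2 * z'))" by simp
    also have "\<dots> \<in> ideal2 n" using c z z' w by (intro ideal2I Z2_closed Z2_power) auto
    finally show ?thesis .
  qed
  then show ?thesis using ideal2_separated by (metis eq_iff_diff_eq_0)
qed

section \<open>Powers with 2-adic exponents\<close>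

lemma ln2_ideal2:
  assumes "y \<in> Z2"
  shows "ln2 (1 + 8 * y) \<in> ideal2 3"
proof -
  obtain z where z: "z \<in> Z2" "ln2 (1 + 8 * y) = 8 * y * (1 + 2 * z)"
    using ln2_sums [OF assms] by metis
  have "y * (1 + 2 * z) \<in> Z2" using assms z by (intro Z2_closed) auto
  from ideal2I [OF this, of 3] show ?thesis unfolding z(2) by (simp add: mult_ac)
qed

lemma pow2_of_nat:
  assumes "y \<in> Z2"
  shows "pow2 (1 + 8 * y) (of_nat n) = (1 + 8 * y) ^ n"
  unfolding pow2_def exp2_of_nat_mult [OF ln2_ideal2 [OF assms]] exp2_ln2 [OF assms] ..

lemma pow2_one_unit:
  assumes "y \<in> Z2" "s \<in> Z2"
  shows "pow2 (1 + 8 * y) s - 1 \<in> ideal2 3"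
  unfolding pow2_def using assms by (intro exp2_one_unit ideal2_mult_Z2 ln2_ideal2)

lemma pow2_Z2:
  assumes "y \<in> Z2" "s \<in> Z2"
  shows "pow2 (1 + 8 * y) s \<in> Z2"
  using pow2_one_unit [OF assms] by (rule one_unit_Z2)

text \<open>
  The exponential series in \<open>s * ln2 v\<close> is itself a power series in \<open>s\<close>.
\<close>

lemma pow2_analytic:
  assumes "y \<in> Z2"
  shows "two_adic_analytic (\<lambda>s. pow2 (1 + 8 * y) s)"
  unfolding two_adic_analytic_def
proof (intro exI ballI)
  fix s assume "s \<in> Z2"
  then have "s * ln2 (1 + 8 * y) \<in> ideal2 3" by (intro ideal2_mult_Z2 ln2_ideal2 assms)
  from exp2_sums [OF this]
  show "(\<lambda>k. ln2 (1 + 8 * y) ^ k / fact k * s ^ k) sums pow2 (1 + 8 * y) s"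
    by (simp add: pow2_def power_mult_distrib mult_ac)
qed

text \<open>
  The exact size of the difference: \<open>v ^ s - v ^ t = v ^ t * (exp2 ((s - t) * ln2 v) - 1)\<close>, and
  exponential and logarithm both preserve valuations here, up to factors in \<open>1 + 2 Z2\<close>.
\<close>

lemma pow2_diff:
  assumes y: "y \<in> Z2" and s: "s \<in> Z2" and t: "t \<in> Z2"
  obtains e where "e - 1 \<in> ideal2 1"
    "pow2 (1 + 8 * y) s - pow2 (1 + 8 * y) t = 8 * y * (s - t) * e"
proof -
  obtain z where z: "z \<in> Z2" "ln2 (1 + 8 * y) = 8 * y * (1 + 2 * z)"
    using ln2_sums [OF y] by metis
  let ?Y = "(s - t) * y * (1 + 2 * z)"
  have Y: "?Y \<in> Z2" using assms z by (intro Z2_closed) auto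
  then obtain z' where z': "z' \<in> Z2" "exp2 (8 * ?Y) = 1 + 8 * ?Y + 32 * ?Y ^ 2 * z'"
    by (rule exp2_quadratic)
  have "s * ln2 (1 + 8 * y) = t * ln2 (1 + 8 * y) + 8 * ?Y"
    unfolding z(2) by (simp add: algebra_simps)
  then have "pow2 (1 + 8 * y) s = exp2 (t * ln2 (1 + 8 * y) + 8 * ?Y)"
    by (simp only: pow2_def)
  also have "\<dots> = pow2 (1 + 8 * y) t * exp2 (8 * ?Y)"
    unfolding pow2_def
  proof (rule exp2_add)
    show "t * ln2 (1 + 8 * y) \<in> ideal2 3" by (intro ideal2_mult_Z2 ln2_ideal2 t y)
    show "8 * ?Y \<in> ideal2 3" using ideal2I [OF Y, of 3] by simp
  qed
  finally have "pow2 (1 + 8 * y) s - pow2 (1 + 8 * y) t =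
      8 * y * (s - t) * (pow2 (1 + 8 * y) t * ((1 + 2 * z) * (1 + 4 * ?Y * z')))"
    unfolding z' by (simp add: algebra_simps power2_eq_square)
  moreover have "pow2 (1 + 8 * y) t * ((1 + 2 * z) * (1 + 4 * ?Y * z')) - 1 \<in> ideal2 1"
  proof (intro one_unit_mult)
    show "pow2 (1 + 8 * y) t - 1 \<in> ideal2 1"
      using pow2_one_unit [OF y t] ideal2_antimono [of 1 3] by auto
    show "1 + 2 * z - 1 \<in> ideal2 1" using ideal2I [OF z(1), of 1] by simp
    have "2 * ?Y * z' \<in> Z2" using z' assms z by (intro Z2_closed) auto
    from ideal2I [OF this, of 1] show "1 + 4 * ?Y * z' - 1 \<in> ideal2 1" by (simp add: mult_ac)
  qed
  ultimately show thesis by (intro that)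
qed

section \<open>Analytic functions\<close>

lemma two_adic_analytic_add:
  assumes "two_adic_analytic f" "two_adic_analytic g"
  shows "two_adic_analytic (\<lambda>s. f s + g s)"
proof -
  obtain a b where "\<forall>s\<in>Z2. (\<lambda>k. a k * s ^ k) sums f s" "\<forall>s\<in>Z2. (\<lambda>k. b k * s ^ k) sums g s"
    using assms unfolding two_adic_analytic_def by blast
  then have "\<forall>s\<in>Z2. (\<lambda>k. (a k + b k) * s ^ k) sums (f s + g s)"
    by (auto simp: distrib_right intro: sums_add)
  then show ?thesis
    unfolding two_adic_analytic_def by (intro exI [of _ "\<lambda>k. a k + b k"])
qed

lemma two_adic_analytic_cmult:
  assumes "c \<in> Z2" "two_adic_analytic f"
  shows "two_adic_analytic (\<lambda>s. c * f s)"
proof -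
  obtain a where "\<forall>s\<in>Z2. (\<lambda>k. a k * s ^ k) sums f s"
    using assms unfolding two_adic_analytic_def by blast
  then have "\<forall>s\<in>Z2. (\<lambda>k. (c * a k) * s ^ k) sums (c * f s)"
    by (auto simp: mult.assoc intro: sums_cmult_Z2 assms)
  then show ?thesis
    unfolding two_adic_analytic_def by (intro exI [of _ "\<lambda>k. c * a k"])
qed

lemma two_adic_analytic_sum:
  assumes "finite A" "\<And>i. i \<in> A \<Longrightarrow> two_adic_analytic (f i)"
  shows "two_adic_analytic (\<lambda>s. \<Sum>i\<in>A. f i s)"
  using assms
proof (induction A rule: finite_induct)
  case empty
  show ?case unfolding two_adic_analytic_def by (auto intro: exI [of _ "\<lambda>_. 0"])
qed (auto intro: two_adic_analytic_add)

section \<open>Coefficients of the series\<close>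

lemma two_tri: "2 * tri k = k * (k + 1)"
  unfolding tri_def by simp

lemma square_odd: "(2 * k + 1) ^ 2 = 8 * tri k + (1 :: nat)"
proof -
  have "(2 * k + 1) ^ 2 = 4 * (2 * tri k) + 1"
    unfolding two_tri by (simp add: power2_eq_square algebra_simps)
  then show ?thesis by simp
qed

text \<open>
  Both sides depend only on \<open>k\<close> modulo 4.
\<close>

lemma chi8_odd: "chi8 (2 * k + 1) = (- 1) ^ tri k"
proof -
  define j where "j = k div 4"
  have "k mod 4 = 0 \<or> k mod 4 = 1 \<or> k mod 4 = 2 \<or> k mod 4 = 3" by linarith
  moreover have "k = 4 * j + k mod 4" unfolding j_def by simp
  ultimately consider "k = 4 * j" | "k = 4 * j + 1" | "k = 4 * j + 2" | "k = 4 * j + 3"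
    by linarith
  then show ?thesis
  proof cases
    case 1
    then have "tri k = 2 * (j * (4 * j + 1))" using two_tri [of k] by (simp add: algebra_simps)
    then have "even (tri k)" by simp
    moreover have "(2 * k + 1) mod 8 = 1" using 1 by presburger
    ultimately show ?thesis by (simp add: chi8_eq)
  next
    case 2
    then have "tri k = 2 * (4 * j * j + 3 * j) + 1" using two_tri [of k] by (simp add: algebra_simps)
    then have "odd (tri k)" by simp
    moreover have "(2 * k + 1) mod 8 = 3" using 2 by presburger
    ultimately show ?thesis by (simp add: chi8_eq)
  next
    case 3
    then have "tri k = 2 * (4 * j * j + 5 * j + 1) + 1" using two_tri [of k] by (simp add: algebra_simps)
    then have "odd (tri k)" by simp
    moreover have "(2 * k + 1) mod 8 = 5" using 3 by presburger
    ultimately show ?thesis by (simp add: chi8_eq)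
  next
    case 4
    then have "tri k = 2 * (4 * j * j + 7 * j + 3)" using two_tri [of k] by (simp add: algebra_simps)
    then have "even (tri k)" by simp
    moreover have "(2 * k + 1) mod 8 = 7" using 4 by presburger
    ultimately show ?thesis by (simp add: chi8_eq)
  qed
qed

text \<open>
  The substitution \<open>m = 2 * k + 1\<close> turns the sum over odd \<open>m\<close> into the sum over triangular numbers
  that defines \<^const>\<open>N_ser\<close>.
\<close>

lemma N_adic_nth:
  "fps_nth (N_adic s) r =
    (\<Sum>k | tri k = r. (- 1) ^ tri k * of_nat (2 * k + 1) * pow2 (1 + 8 * of_nat (tri k)) s)"
proof -
  have "fps_nth (N_adic s) r = (\<Sum>m | m \<ge> 1 \<and> odd m \<and> (m ^ 2 - 1) div 8 = r.
      of_int (chi8 m) * of_nat m * pow2 (of_nat (m ^ 2)) s)"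
    by (simp add: N_adic_def)
  also have "\<dots> = (\<Sum>k | tri k = r.
      of_int (chi8 (2 * k + 1)) * of_nat (2 * k + 1) * pow2 (of_nat ((2 * k + 1) ^ 2)) s)"
  proof (rule sum.reindex_bij_witness [of _ "\<lambda>k. 2 * k + 1" "\<lambda>m. m div 2"])
    fix m assume m: "m \<in> {m. m \<ge> 1 \<and> odd m \<and> (m ^ 2 - 1) div 8 = r}"
    then show eq: "2 * (m div 2) + 1 = m" by simp
    show "m div 2 \<in> {k. tri k = r}"
      using m square_odd [of "m div 2"] unfolding eq by simp
    show "of_int (chi8 (2 * (m div 2) + 1)) * of_nat (2 * (m div 2) + 1) *
        pow2 (of_nat ((2 * (m div 2) + 1) ^ 2)) s = of_int (chi8 m) * of_nat m * pow2 (of_nat (m ^ 2)) s"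
      unfolding eq ..
  next
    fix k assume k: "k \<in> {k. tri k = r}"
    show "(2 * k + 1) div 2 = k" by simp
    show "2 * k + 1 \<in> {m. m \<ge> 1 \<and> odd m \<and> (m ^ 2 - 1) div 8 = r}"
      using k unfolding mem_Collect_eq square_odd by simp
  qed
  also have "\<dots> = (\<Sum>k | tri k = r.
      (- 1) ^ tri k * of_nat (2 * k + 1) * pow2 (1 + 8 * of_nat (tri k)) s)"
  proof -
    have "of_nat ((2 * k + 1) ^ 2) = (1 + 8 * of_nat (tri k) :: two_adic)" for k
      unfolding square_odd by simp
    then show ?thesis
      by (simp only: chi8_odd of_int_power of_int_minus of_int_1)
  qed
  finally show ?thesis .
qed

lemma tri_eq_0: "{k. tri k = 0} = {0}"
proof -
  have "k = 0" if "tri k = 0" for k using le_tri [of k] that by simp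
  moreover have "tri 0 = 0" by (simp add: tri_def)
  ultimately show ?thesis by blast
qed

lemma tri_eq_1: "{k. tri k = 1} = {1}"
proof -
  have t: "tri 0 = 0" "tri 1 = 1" by (simp_all add: tri_def)
  have "k = 1" if "tri k = 1" for k
  proof -
    have "k \<noteq> 0" using t(1) that by (intro notI) simp
    with le_tri [of k] that show ?thesis by simp
  qed
  with t(2) show ?thesis by blast
qed

lemma pow2_1 [simp]: "pow2 1 s = 1"
  by (simp add: pow2_def ln2_def)

lemma N_adic_nth_0: "fps_nth (N_adic s) 0 = 1"
  unfolding N_adic_nth tri_eq_0 by (simp add: tri_def)

lemma N_adic_nth_1: "fps_nth (N_adic s) 1 = - 3 * pow2 9 s"
  unfolding N_adic_nth tri_eq_1 by (simp add: tri_def)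

lemma sign_odd_Z2: "(- 1) ^ tri k * of_nat (2 * k + 1) \<in> Z2"
  by (intro Z2_closed(4) Z2_power Z2_of_nat Z2_closed(3) [OF Z2_1 Z2_1])

lemma N_adic_Z2:
  assumes "s \<in> Z2"
  shows "fps_nth (N_adic s) r \<in> Z2"
  unfolding N_adic_nth by (intro Z2_sum Z2_closed(4) [OF sign_odd_Z2] pow2_Z2 assms Z2_of_nat)

lemma N_adic_analytic: "two_adic_analytic (\<lambda>s. fps_nth (N_adic s) r)"
  unfolding N_adic_nth
  by (intro two_adic_analytic_sum two_adic_analytic_cmult finite_tri_eq sign_odd_Z2 pow2_analytic
      Z2_of_nat)

lemma N_adic_of_nat: "N_adic (of_nat n) = fps_of_int_fps (N_ser n)"
proof (rule fps_ext)
  fix r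
  have "(- 1) ^ tri k * of_nat (2 * k + 1) * pow2 (1 + 8 * of_nat (tri k)) (of_nat n) =
      (of_int ((- 1) ^ tri k * int (2 * k + 1) ^ (2 * n + 1)) :: two_adic)" for k
  proof -
    have "pow2 (1 + 8 * of_nat (tri k)) (of_nat n) = (of_nat ((2 * k + 1) ^ 2)) ^ n"
      unfolding pow2_of_nat [OF Z2_of_nat] square_odd by (simp add: add.commute)
    also have "\<dots> = of_nat (2 * k + 1) ^ (2 * n)" by (simp only: of_nat_power power_mult)
    finally show ?thesis
      by (simp only: of_int_mult of_int_power of_int_of_nat_eq of_int_minus of_int_1 power_add power_one_right mult_ac)
  qed
  then show "fps_nth (N_adic (of_nat n)) r = fps_nth (fps_of_int_fps (N_ser n)) r"
    unfolding N_adic_nth fps_of_int_fps_def N_ser_def fps_nth_Abs_fps of_int_sum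
    by (intro sum.cong refl)
qed

lemma fps_of_int_fps_mult:
  "fps_of_int_fps (F * G) = fps_of_int_fps F * fps_of_int_fps G"
  by (rule fps_ext) (simp add: fps_of_int_fps_def fps_mult_nth)

lemma fps_of_int_fps_1: "fps_of_int_fps 1 = 1"
  by (rule fps_ext) (simp add: fps_of_int_fps_def)

text \<open>
  The inverse of \<open>D\<close> exists over the integers because its constant term is 1; multiplication by it
  therefore preserves integrality and congruences.
\<close>

definition D_inv :: "int fps"
  where "D_inv = fps_right_inverse D_ser 1"

lemma D_ser_mult_D_inv: "D_ser * D_inv = 1"
  using fps_right_inverse [of D_ser 1] D_ser_0 by (simp add: D_inv_def)

lemma D_inv_0: "fps_nth D_inv 0 = 1"
  using arg_cong [OF D_ser_mult_D_inv, of "\<lambda>F. fps_nth F 0"] D_ser_0 by simp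

lemma D_inv_1: "fps_nth D_inv 1 = 3"
proof -
  have "fps_nth D_ser 1 = - 3"
    unfolding D_ser_def N_ser_def fps_nth_Abs_fps tri_eq_1 by (simp add: tri_def)
  then show ?thesis
    using arg_cong [OF D_ser_mult_D_inv, of "\<lambda>F. fps_nth F 1"] D_ser_0 D_inv_0
    by (simp add: fps_mult_nth)
qed

lemma W_adic_eq: "W_adic s = N_adic s * fps_of_int_fps D_inv"
proof -
  have D0: "fps_nth (fps_of_int_fps D_ser) 0 \<noteq> 0" by (simp add: fps_of_int_fps_def D_ser_0)
  have "fps_of_int_fps D_ser * fps_of_int_fps D_inv = 1"
    by (simp add: D_ser_mult_D_inv fps_of_int_fps_1 flip: fps_of_int_fps_mult)
  then have "inverse (fps_of_int_fps D_ser) = fps_of_int_fps D_inv"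
    by (rule fps_inverse_unique)
  then show ?thesis unfolding W_adic_def fps_divide_unit [OF D0] by simp
qed

text \<open>
  The integral coefficients in this finite combination do not depend on \<open>s\<close>. So integrality,
  analyticity and congruences pass from \<^const>\<open>N_adic\<close> to \<^const>\<open>W_adic\<close>.
\<close>

lemma W_adic_nth:
  "fps_nth (W_adic s) r = (\<Sum>i=0..r. of_int (fps_nth D_inv (r - i)) * fps_nth (N_adic s) i)"
  unfolding W_adic_eq fps_mult_nth by (simp add: fps_of_int_fps_def mult.commute)

lemma W_adic_nth_1: "fps_nth (W_adic s) 1 = 3 * (1 - pow2 9 s)"
  unfolding W_adic_nth using N_adic_nth_0 N_adic_nth_1 D_inv_0 D_inv_1
  by (simp add: algebra_simps)

text \<open>
  The coefficient is \<open>- 3 * (9 ^ s - 9 ^ t)\<close>, and \<open>9 = 1 + 8 * 1\<close> has the smallest valuation of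
  \<open>v - 1\<close> that is possible for a square \<open>v\<close> of an odd number. This one coefficient shows that the
  congruence is optimal.
\<close>

lemma W_adic_diff_nth_1:
  assumes "s \<in> Z2" "t \<in> Z2"
  obtains u v where "fps_nth (W_adic s - W_adic t) 1 = 8 * (s - t) * u"
    "u \<in> Z2" "v \<in> Z2" "u * v = 1"
proof -
  obtain e where e: "e - 1 \<in> ideal2 1" "pow2 (1 + 8 * 1) s - pow2 (1 + 8 * 1) t = 8 * 1 * (s - t) * e"
    using pow2_diff [OF Z2_1 assms] by blast
  \<comment> \<open>The factor \<open>- 3 = 1 + 2 * (- 2)\<close> is a unit.\<close>
  have "2 ^ 1 * - 2 \<in> ideal2 1" by (intro ideal2I Z2_closed) auto
  then have "- 3 * e - 1 \<in> ideal2 1" using e(1) by (intro one_unit_mult) auto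
  then obtain v where v: "v \<in> Z2" "- 3 * e * v = 1" by (rule unit_odd)
  have "fps_nth (W_adic s - W_adic t) 1 = - 3 * (pow2 9 s - pow2 9 t)"
    by (simp only: fps_sub_nth W_adic_nth_1) (simp add: algebra_simps)
  also have "\<dots> = 8 * (s - t) * (- 3 * e)" using e(2) by simp
  finally have *: "fps_nth (W_adic s - W_adic t) 1 = 8 * (s - t) * (- 3 * e)" .
  have "e \<in> Z2" using e(1) by (rule one_unit_Z2)
  then have "- 3 * e \<in> Z2" by (intro Z2_closed) auto
  with * v show thesis by (intro that)
qed

lemma W_adic_diff_nth:
  assumes "s \<in> Z2" "t \<in> Z2"
  obtains z where "z \<in> Z2" "fps_nth (W_adic s) r - fps_nth (W_adic t) r = 8 * (s - t) * z"
proof -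
  have "\<exists>z\<in>Z2. pow2 (1 + 8 * of_nat j) s - pow2 (1 + 8 * of_nat j) t = 8 * (s - t) * z" for j
  proof -
    obtain e where e: "e - 1 \<in> ideal2 1"
      "pow2 (1 + 8 * of_nat j) s - pow2 (1 + 8 * of_nat j) t = 8 * of_nat j * (s - t) * e"
      using pow2_diff [OF Z2_of_nat assms] by blast
    have "e \<in> Z2" using e(1) by (rule one_unit_Z2)
    then have "of_nat j * e \<in> Z2" by (intro Z2_closed) auto
    with e(2) show ?thesis by (intro bexI [of _ "of_nat j * e"]) (simp_all add: mult_ac)
  qed
  then obtain p where p: "\<And>j. p j \<in> Z2"
    "\<And>j. pow2 (1 + 8 * of_nat j) s - pow2 (1 + 8 * of_nat j) t = 8 * (s - t) * p j" by metis
  define q where "q i = (\<Sum>k | tri k = i. (- 1) ^ tri k * of_nat (2 * k + 1) * p (tri k))" for i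
  have q: "q i \<in> Z2" for i unfolding q_def by (intro Z2_sum Z2_closed(4) [OF sign_odd_Z2] p)
  have N: "fps_nth (N_adic s) i - fps_nth (N_adic t) i = 8 * (s - t) * q i" for i
    unfolding N_adic_nth q_def sum_distrib_left sum_subtractf [symmetric] right_diff_distrib [symmetric] p(2)
    by (intro sum.cong refl) (simp only: mult_ac)
  have "fps_nth (W_adic s) r - fps_nth (W_adic t) r =
      8 * (s - t) * (\<Sum>i=0..r. of_int (fps_nth D_inv (r - i)) * q i)"
    unfolding W_adic_nth sum_distrib_left sum_subtractf [symmetric] right_diff_distrib [symmetric] N
    by (intro sum.cong refl) (simp only: mult_ac)
  moreover have "(\<Sum>i=0..r. of_int (fps_nth D_inv (r - i)) * q i) \<in> Z2"
    by (intro Z2_sum Z2_closed q Z2_of_int)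
  ultimately show thesis by (intro that)
qed

section \<open>Interpolation and the optimal congruence\<close>

theorem theorem6p4:
  shows
    "(\<forall>s\<in>Z2. \<forall>r. fps_nth (N_adic s) r \<in> Z2 \<and> fps_nth (W_adic s) r \<in> Z2) \<and>
     (\<forall>r. two_adic_analytic (\<lambda>s. fps_nth (N_adic s) r) \<and>
          two_adic_analytic (\<lambda>s. fps_nth (W_adic s) r)) \<and>
     (\<forall>n :: nat. N_adic (of_nat n) = fps_of_int_fps (N_ser n) \<and>
                 W_adic (of_nat n) = fps_of_int_fps (W_ser n)) \<and>
     (\<forall>s\<in>Z2. \<forall>t\<in>Z2. s \<noteq> t \<longrightarrow>
        fps_cong_two_powi (3 + val2 (s - t)) (W_adic s) (W_adic t) \<and>
        (\<forall>e :: int. fps_cong_two_powi e (W_adic s) (W_adic t) \<longrightarrow> e \<le> 3 + val2 (s - t))) \<and>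
     (\<forall>s\<in>Z2. fps_nth (W_adic s) 1 = 3 * (1 - pow2 9 s)) \<and>
     (\<forall>s\<in>Z2. \<forall>t\<in>Z2. s \<noteq> t \<longrightarrow>
        fps_nth (W_adic s - W_adic t) 1 \<noteq> 0 \<and>
        val2 (fps_nth (W_adic s - W_adic t) 1) = 3 + val2 (s - t))"
proof (intro conjI ballI allI impI)
  fix s t r and n :: nat
  show "fps_nth (N_adic s) r \<in> Z2" "fps_nth (W_adic s) r \<in> Z2" if "s \<in> Z2"
    unfolding W_adic_nth using that by (intro N_adic_Z2 Z2_sum Z2_closed Z2_of_int; assumption)+
  show "two_adic_analytic (\<lambda>s. fps_nth (N_adic s) r)" by (rule N_adic_analytic)
  show "two_adic_analytic (\<lambda>s. fps_nth (W_adic s) r)"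
    unfolding W_adic_nth
    by (intro two_adic_analytic_sum two_adic_analytic_cmult N_adic_analytic Z2_of_int) simp
  show "N_adic (of_nat n) = fps_of_int_fps (N_ser n)" by (rule N_adic_of_nat)
  then show "W_adic (of_nat n) = fps_of_int_fps (W_ser n)"
    by (simp add: W_adic_eq W_ser_def D_inv_def fps_of_int_fps_mult)
  show "fps_nth (W_adic s) 1 = 3 * (1 - pow2 9 s)" by (rule W_adic_nth_1)
next
  fix s t assume st: "s \<in> Z2" "t \<in> Z2" "s \<noteq> t"
  have eight: "2 powi (3 + k) = 8 * (2 powi k :: two_adic)" for k
    by (simp add: power_int_add)
  have "s - t \<noteq> 0" using st by simp
  then obtain w w' where w: "s - t = 2 powi val2 (s - t) * w" "w \<in> Z2" "w' \<in> Z2" "w * w' = 1"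
    by (rule two_adic_val2_cases)
  obtain u v where u: "fps_nth (W_adic s - W_adic t) 1 = 8 * (s - t) * u"
    "u \<in> Z2" "v \<in> Z2" "u * v = 1"
    using W_adic_diff_nth_1 [OF st(1,2)] by blast
  have "u \<noteq> 0" using u by auto
  then show nz: "fps_nth (W_adic s - W_adic t) 1 \<noteq> 0" unfolding u(1) using st by simp
  have "fps_nth (W_adic s - W_adic t) 1 = 2 powi (3 + val2 (s - t)) * (w * u)"
    unfolding u(1) eight using w(1) by (metis mult.assoc)
  moreover have "w * u * (w' * v) = 1" using w(4) u(4) by (metis mult.assoc mult.left_commute mult_1_right)
  ultimately show val: "val2 (fps_nth (W_adic s - W_adic t) 1) = 3 + val2 (s - t)"
    using w u by (intro val2_eqI [of _ _ "w * u" "w' * v"] Z2_closed) auto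
  show "fps_cong_two_powi (3 + val2 (s - t)) (W_adic s) (W_adic t)"
    unfolding fps_cong_two_powi_def cong_two_powi_def
  proof
    fix r
    obtain z where z: "z \<in> Z2" "fps_nth (W_adic s) r - fps_nth (W_adic t) r = 8 * (s - t) * z"
      using W_adic_diff_nth [OF st(1,2)] by blast
    have "8 * (s - t) * z = 2 powi (3 + val2 (s - t)) * (w * z)"
      unfolding eight using w(1) by (metis mult.assoc)
    moreover have "w * z \<in> Z2" using w z by (intro Z2_closed)
    ultimately show "\<exists>z\<in>Z2. fps_nth (W_adic s) r - fps_nth (W_adic t) r =
        2 powi (3 + val2 (s - t)) * z"
      unfolding z(2) by blast
  qed
  fix e assume "fps_cong_two_powi e (W_adic s) (W_adic t)"
  then have "\<exists>z\<in>Z2. fps_nth (W_adic s - W_adic t) 1 = 2 powi e * z"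
    unfolding fps_cong_two_powi_def cong_two_powi_def by simp
  then have "val2 (fps_nth (W_adic s - W_adic t) 1) \<ge> e" using val2_ge_iff [OF nz] by blast
  then show "e \<le> 3 + val2 (s - t)" unfolding val .
qed

end
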